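(* The universal alternative enveloping algebra $A(\mathbb{M})=U(\mathbb{M})/I(\mathbb{M})$ is isomorphic to the $\mathbb{F}$-algebra with basis $$\{\,a^ib^jc^kd^\ell,\ a^ib^jd^\ell e \;|\; i,j,k,\ell\ge 0\,\}$$ (formal symbols, pairwise distinct) and multiplication given, for all integers $i,j,k,\ell,p,q,r,s\ge 0$, by \begin{align*} (a^i b^j d^\ell e)(a^p b^q d^s e)&=0,\\ (a^i b^j c^k d^\ell)(a^p b^q d^s e)&=\delta_{k0}\,a^{i+p}b^{j+q}d^{\ell+s}e,\\ (a^i b^j d^\ell e)(a^p b^q c^r d^s)&=\delta_{r0}\,a^{i+p}b^{j+q}d^{\ell+s}e,\\ (a^i b^j c^k d^\ell)(a^p b^q c^r d^s)&=\sum_{\mu=0}^{j}(-1)^\mu\mu!\binom{j}{\mu}\binom{p}{\mu}a^{i+p-\mu}b^{j+q-\mu}c^{k+r+\mu}d^{\ell+s}\\ &\quad+\delta_{k0}\delta_{r0}\left(\tfrac16 ijs-\tfrac16 i\ell q+\tfrac12 j\ell p+\tfrac13 jps-\tfrac13\ell pq\right)a^{i+p-1}b^{j+q-1}d^{\ell+s-1}e\\ &\quad-\delta_{k0}\delta_{r1}\,\ell\,a^{i+p}b^{j+q}d^{\ell+s-1}e. \end{align*}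
   Context: Let $\mathbb{F}$ be a field of characteristic $\ne 2,3$. $\mathbb{M}$ is the 5-dimensional nilpotent (non-Lie) Malcev algebra over $\mathbb{F}$ with basis $a,b,c,d,e$ and anticommutative product determined by $[a,b]=c$, $[c,d]=e$ (so $[b,a]=-c$, $[d,c]=-e$), all other products of basis elements being $0$. The universal nonassociative enveloping algebra is $U(\mathbb{M})=F(\mathbb{M})/R(\mathbb{M})$, where $F(\mathbb{M})$ is the unital free nonassociative $\mathbb{F}$-algebra on $\{a,b,c,d,e\}$ (with $\mathbb{M}$ viewed as the span of the generators) and $R(\mathbb{M})$ is the two-sided ideal generated by $fg-gf-[f,g]$, $(f,x,y)+(x,f,y)$, $(x,f,y)+(x,y,f)$ for all $f,g\in\mathbb{M}$, $x,y\in F(\mathbb{M})$; here $(x,y,z)=(xy)z-x(yz)$. By a theorem of Pérez-Izquierdo and Shestakov, $\mathbb{M}\to U(\mathbb{M})$ is injective and $U(\mathbb{M})$ has as a basis the left-tapped monomials $x_1(x_2(\cdots(x_{n-1}x_n)\cdots))$ with $n\ge 0$, $x_1\le\cdots\le x_n$ in the order $a<b<c<d<e$ (the empty monomial being $1$). The alternator ideal $I(\mathbb{M})$ is the two-sided ideal of $U(\mathbb{M})$ generated by all $(x,x,y)$ and $(y,x,x)$ with $x,y\in U(\mathbb{M})$. $\delta_{xy}$ is the Kronecker delta. Terms with zero coefficient are $0$ even if a negative exponent appears formally in them. *)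

theory Defs
  imports "HOL-Algebra.Module" "HOL-Algebra.QuotRing" "HOL-Library.Poly_Mapping"
begin

text \<open>
  A (unital, not necessarily associative) algebra over a field \<open>'f\<close> is represented by a record
  of type \<open>('f, 'a) module\<close>: the operations \<open>\<oplus>\<close>, \<open>\<otimes>\<close>, \<open>\<zero>\<close>, \<open>\<one>\<close> together with the scalar
  multiplication \<open>\<odot>\<close>.  Only the record type and definitions of HOL-Algebra that are
  meaningful for nonassociative rings are used, not the locales \<open>ring\<close>, \<open>ideal\<close> or \<open>module\<close>.
\<close>

section \<open>Algebras given by a basis\<close>

text \<open>Vectors over a basis \<open>'b\<close> are finitely supported functions \<open>'b \<Rightarrow>\<^sub>0 'f\<close>.\<close>

definition scale :: "'f::field \<Rightarrow> ('b \<Rightarrow>\<^sub>0 'f) \<Rightarrow> ('b \<Rightarrow>\<^sub>0 'f)"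
  where "scale c x = Poly_Mapping.map (\<lambda>t. c * t) x"

definition bilinear_ext ::
    "('b \<Rightarrow> 'b \<Rightarrow> ('b \<Rightarrow>\<^sub>0 'f::field)) \<Rightarrow> ('b \<Rightarrow>\<^sub>0 'f) \<Rightarrow> ('b \<Rightarrow>\<^sub>0 'f) \<Rightarrow> ('b \<Rightarrow>\<^sub>0 'f)"
  where "bilinear_ext m x y =
    (\<Sum>u \<in> Poly_Mapping.keys x. \<Sum>v \<in> Poly_Mapping.keys y.
       scale (Poly_Mapping.lookup x u * Poly_Mapping.lookup y v) (m u v))"

text \<open>The algebra with basis \<open>'b\<close>, multiplication table \<open>m\<close>, and the basis element \<open>u\<close> as unit.\<close>

definition basis_algebra ::
    "('b \<Rightarrow> 'b \<Rightarrow> ('b \<Rightarrow>\<^sub>0 'f::field)) \<Rightarrow> 'b \<Rightarrow> ('f, 'b \<Rightarrow>\<^sub>0 'f) module"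
  where "basis_algebra m u =
    \<lparr>carrier = UNIV, mult = bilinear_ext m, one = Poly_Mapping.single u 1,
     zero = 0, add = (+), smult = scale\<rparr>"


section \<open>Ideals, quotients, isomorphisms\<close>

definition alg_ideal :: "'a set \<Rightarrow> ('f, 'a) module \<Rightarrow> bool"
  where "alg_ideal I A \<longleftrightarrow>
    I \<subseteq> carrier A \<and> \<zero>\<^bsub>A\<^esub> \<in> I \<and>
    (\<forall>x\<in>I. \<forall>y\<in>I. x \<oplus>\<^bsub>A\<^esub> y \<in> I) \<and>
    (\<forall>c. \<forall>x\<in>I. c \<odot>\<^bsub>A\<^esub> x \<in> I) \<and>
    (\<forall>x\<in>I. \<forall>y\<in>carrier A. x \<otimes>\<^bsub>A\<^esub> y \<in> I \<and> y \<otimes>\<^bsub>A\<^esub> x \<in> I)"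

definition generated_ideal :: "('f, 'a) module \<Rightarrow> 'a set \<Rightarrow> 'a set"
  where "generated_ideal A S = \<Inter>{I. alg_ideal I A \<and> S \<subseteq> I}"

text \<open>All fields but the last one are those of \<^const>\<open>FactRing\<close>.\<close>

definition quotient_algebra :: "('f, 'a) module \<Rightarrow> 'a set \<Rightarrow> ('f, 'a set) module"
  where "quotient_algebra A I =
    \<lparr>carrier = a_rcosets\<^bsub>A\<^esub> I, mult = rcoset_mult A I, one = I +>\<^bsub>A\<^esub> \<one>\<^bsub>A\<^esub>,
     zero = I, add = set_add A,
     smult = (\<lambda>c X. \<Union>x\<in>X. I +>\<^bsub>A\<^esub> (c \<odot>\<^bsub>A\<^esub> x))\<rparr>"

definition alg_iso :: "('f, 'a) module \<Rightarrow> ('f, 'b) module \<Rightarrow> ('a \<Rightarrow> 'b) set"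
  where "alg_iso A B =
    {h \<in> ring_iso A B. \<forall>c. \<forall>x\<in>carrier A. h (c \<odot>\<^bsub>A\<^esub> x) = c \<odot>\<^bsub>B\<^esub> h x}"

definition associator :: "('f, 'a) module \<Rightarrow> 'a \<Rightarrow> 'a \<Rightarrow> 'a \<Rightarrow> 'a"
  where "associator A x y z = ((x \<otimes>\<^bsub>A\<^esub> y) \<otimes>\<^bsub>A\<^esub> z) \<ominus>\<^bsub>A\<^esub> (x \<otimes>\<^bsub>A\<^esub> (y \<otimes>\<^bsub>A\<^esub> z))"


section \<open>The free nonassociative algebra and the enveloping algebras\<close>

datatype 'g word = Gen 'g | Prod "'g word" "'g word"

text \<open>
  The free unital magma on \<open>'g\<close> is \<open>'g word option\<close>, where \<^const>\<open>None\<close> is the empty monomial \<open>1\<close>.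
\<close>

fun monomial_mult :: "'g word option \<Rightarrow> 'g word option \<Rightarrow> 'g word option"
  where
    "monomial_mult None v = v"
  | "monomial_mult u None = u"
  | "monomial_mult (Some u) (Some v) = Some (Prod u v)"

definition free_algebra :: "('f::field, 'g word option \<Rightarrow>\<^sub>0 'f) module"
  where "free_algebra = basis_algebra (\<lambda>u v. Poly_Mapping.single (monomial_mult u v) 1) None"

text \<open>The linear embedding of the space with basis \<open>'g\<close> as the span of the generators.\<close>

definition gen_embed :: "('g \<Rightarrow>\<^sub>0 'f::field) \<Rightarrow> ('g word option \<Rightarrow>\<^sub>0 'f)"
  where "gen_embed f =
    (\<Sum>g \<in> Poly_Mapping.keys f. Poly_Mapping.single (Some (Gen g)) (Poly_Mapping.lookup f g))"

text \<open>In the following, \<open>br\<close> is the bracket of a Malcev algebra with basis \<open>'g\<close>.\<close>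

definition env_relators ::
    "(('g \<Rightarrow>\<^sub>0 'f) \<Rightarrow> ('g \<Rightarrow>\<^sub>0 'f) \<Rightarrow> ('g \<Rightarrow>\<^sub>0 'f::field)) \<Rightarrow> ('g word option \<Rightarrow>\<^sub>0 'f) set"
  where "env_relators br =
    (let F = free_algebra; \<iota> = gen_embed in
      {((\<iota> f \<otimes>\<^bsub>F\<^esub> \<iota> g) \<ominus>\<^bsub>F\<^esub> (\<iota> g \<otimes>\<^bsub>F\<^esub> \<iota> f)) \<ominus>\<^bsub>F\<^esub> \<iota> (br f g) | f g. True} \<union>
      {associator F (\<iota> f) x y \<oplus>\<^bsub>F\<^esub> associator F x (\<iota> f) y | f x y. True} \<union>
      {associator F x (\<iota> f) y \<oplus>\<^bsub>F\<^esub> associator F x y (\<iota> f) | f x y. True})"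

definition nonassoc_env ::
    "(('g \<Rightarrow>\<^sub>0 'f) \<Rightarrow> ('g \<Rightarrow>\<^sub>0 'f) \<Rightarrow> ('g \<Rightarrow>\<^sub>0 'f::field)) \<Rightarrow> ('f, ('g word option \<Rightarrow>\<^sub>0 'f) set) module"
  where "nonassoc_env br =
    quotient_algebra free_algebra (generated_ideal free_algebra (env_relators br))"

definition alternator_ideal :: "('f, 'a) module \<Rightarrow> 'a set"
  where "alternator_ideal A = generated_ideal A
    ({associator A x x y | x y. x \<in> carrier A \<and> y \<in> carrier A} \<union>
     {associator A y x x | x y. x \<in> carrier A \<and> y \<in> carrier A})"

definition alternative_env ::
    "(('g \<Rightarrow>\<^sub>0 'f) \<Rightarrow> ('g \<Rightarrow>\<^sub>0 'f) \<Rightarrow> ('g \<Rightarrow>\<^sub>0 'f::field))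
      \<Rightarrow> ('f, ('g word option \<Rightarrow>\<^sub>0 'f) set set) module"
  where "alternative_env br =
    quotient_algebra (nonassoc_env br) (alternator_ideal (nonassoc_env br))"


section \<open>The five-dimensional nilpotent Malcev algebra\<close>

datatype gen = a | b | c | d | e

fun malcev_table :: "gen \<Rightarrow> gen \<Rightarrow> (gen \<Rightarrow>\<^sub>0 'f::field)"
  where
    "malcev_table a b = Poly_Mapping.single c 1"
  | "malcev_table b a = Poly_Mapping.single c (-1)"
  | "malcev_table c d = Poly_Mapping.single e 1"
  | "malcev_table d c = Poly_Mapping.single e (-1)"
  | "malcev_table _ _ = 0"

definition malcev_bracket :: "(gen \<Rightarrow>\<^sub>0 'f::field) \<Rightarrow> (gen \<Rightarrow>\<^sub>0 'f) \<Rightarrow> (gen \<Rightarrow>\<^sub>0 'f)"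
  where "malcev_bracket = bilinear_ext malcev_table"

hide_const (open) a b c d e


section \<open>The algebra given by structure constants\<close>

text \<open>\<open>ABCD i j k l\<close> is the symbol \<open>a\<^sup>i b\<^sup>j c\<^sup>k d\<^sup>l\<close>, and \<open>ABDE i j l\<close> is \<open>a\<^sup>i b\<^sup>j d\<^sup>l e\<close>.\<close>

datatype symb = ABCD nat nat nat nat | ABDE nat nat nat

text \<open>
  The truncated subtractions in the exponents are harmless: whenever one of them truncates,
  the corresponding coefficient vanishes.
\<close>

fun symb_table :: "symb \<Rightarrow> symb \<Rightarrow> (symb \<Rightarrow>\<^sub>0 'f::field)"
  where
    "symb_table (ABDE i j l) (ABDE p q s) = 0"
  | "symb_table (ABCD i j k l) (ABDE p q s) =
       Poly_Mapping.single (ABDE (i + p) (j + q) (l + s)) (of_bool (k = 0))"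
  | "symb_table (ABDE i j l) (ABCD p q r s) =
       Poly_Mapping.single (ABDE (i + p) (j + q) (l + s)) (of_bool (r = 0))"
  | "symb_table (ABCD i j k l) (ABCD p q r s) =
       (\<Sum>\<mu> = 0..j.
          Poly_Mapping.single (ABCD (i + p - \<mu>) (j + q - \<mu>) (k + r + \<mu>) (l + s))
            ((-1) ^ \<mu> * of_nat (fact \<mu> * (j choose \<mu>) * (p choose \<mu>))))
     + Poly_Mapping.single (ABDE (i + p - 1) (j + q - 1) (l + s - 1))
         (of_bool (k = 0) * of_bool (r = 0) *
            (1/6 * of_nat (i * j * s) - 1/6 * of_nat (i * l * q) + 1/2 * of_nat (j * l * p)
             + 1/3 * of_nat (j * p * s) - 1/3 * of_nat (l * p * q)))
     - Poly_Mapping.single (ABDE (i + p) (j + q) (l + s - 1))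
         (of_bool (k = 0) * of_bool (r = 1) * of_nat l)"

definition symb_algebra :: "('f::field, symb \<Rightarrow>\<^sub>0 'f) module"
  where "symb_algebra = basis_algebra symb_table (ABCD 0 0 0 0)"

end

theory Submission
  imports Defs Complex_Main "HOL-Library.Product_Plus"
begin

text \<open>
  The symbol algebra \<open>B\<close> is an extension of an associative algebra on the polynomials in
  \<open>a, b, c, d\<close> by the square-zero ideal spanned by the \<open>a\<^sup>i b\<^sup>j d\<^sup>l e\<close>, on which \<open>c\<close> acts as zero.
  Its cocycle is a bidifferential operator whose coboundary is one sixth of the Jacobian determinant in
  \<open>a, b, d\<close>.  Hence the associator of \<open>B\<close> is alternating, and \<open>B\<close> is a quotient of \<open>A(M)\<close>.

  Conversely, every alternative algebra satisfies
  \<open>(f,g,hx) = h(f,g,x) + (f,g,h)x - ([f,g],h,x)\<close>.  In \<open>A(M)\<close> it implies that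
  \<open>(e,f,x) = (c,f,x) = 0\<close> for every generator \<open>f\<close>, that \<open>e\<close> is central, and that \<open>ce = ee = 0\<close>.  These relations suffice to
  reorder products modulo the elements \<open>a\<^sup>i(b\<^sup>j(d\<^sup>l e))\<close>, so the left-tapped words
  \<open>a\<^sup>i(b\<^sup>j(c\<^sup>k d\<^sup>l))\<close> and \<open>a\<^sup>i(b\<^sup>j(d\<^sup>l e))\<close> span \<open>A(M)\<close>.  Their images in \<open>B\<close> are the basis
  elements, so \<open>A(M) \<rightarrow> B\<close> is injective.
\<close>

section \<open>Linear extension of maps given on a basis\<close>

text \<open>The constant 1/6 comes from the Jacobi sum: in an alternative algebra this sum of double
  commutators equals 6(x,y,z), and for a, b, d its only nonzero summand is [[a,b],d] = [c,d] = e.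
  Hence (a,b,d) = e/6, and characteristics 2 and 3 are excluded so that such relations can be
  divided by 6. Spanning and independence are kept apart. Reordering words shows only that the
  left-tapped words span, so no confluence of the reordering rules has to be checked; independence
  is read off from evaluation in \<open>symb_algebra\<close>, where each of these words evaluates to
  one symbol. A second obstacle is the shape of A(M): it is a quotient of a quotient, with cosets of
  cosets as elements. The computations take place in one quotient of the free algebra, by the ideal
  generated by both sets of relations, and only the resulting description of the kernel of
  \<open>ev\<close> is carried back to the iterated quotient.\<close>

lemma lookup_scale [simp]: "Poly_Mapping.lookup (scale t x) u = t * Poly_Mapping.lookup x u"
  by (simp add: scale_def Poly_Mapping.map.rep_eq when_def)

interpretation scale: vector_space scale
  by unfold_locales (auto intro!: poly_mapping_eqI simp: lookup_add algebra_simps)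

lemma scale_single [simp]: "scale t (Poly_Mapping.single u s) = Poly_Mapping.single u (t * s)"
  by (auto intro!: poly_mapping_eqI simp: lookup_single when_def)

text \<open>Scalars become constant polynomials, so identities that mix scalars with products reduce
  to the commutative ring axioms.\<close>

lemma scale_eq_mult: "scale t x = Poly_Mapping.single 0 t * x"
  by (simp add: scale_def mult_map_scale_conv_mult)

lemma scale_mult_left: "scale t (x * y) = scale t x * y"
  and scale_mult_right: "scale t (x * y) = x * scale t (y :: 'm::comm_monoid_add \<Rightarrow>\<^sub>0 'f::field)"
  by (simp_all add: scale_eq_mult ac_simps)

lemma poly_mapping_additive_induct [case_names single add]:
  assumes "\<And>u t. P (Poly_Mapping.single u t)" "\<And>x y. P x \<Longrightarrow> P y \<Longrightarrow> P (x + y)"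
  shows "P (x :: 'b \<Rightarrow>\<^sub>0 'f::field)"
proof (induction x rule: update_induct)
  case const
  show ?case using assms(1)[of undefined 0] by simp
next
  case (update f u t)
  have "Poly_Mapping.update u t f = f + Poly_Mapping.single u t"
    using update(1) by (auto intro!: poly_mapping_eqI
      simp: lookup_update lookup_add lookup_single when_def in_keys_iff)
  with assms(1)[of u t] assms(2) update(3) show ?case by simp
qed

text \<open>The scalar multiplication \<open>s\<close> is a parameter because the targets differ:
  polynomials, symbols, words and the quotient type \<open>alt_alg\<close>.\<close>

definition lin_ext :: "('f::field \<Rightarrow> 'v::ab_group_add \<Rightarrow> 'v) \<Rightarrow> ('b \<Rightarrow> 'v) \<Rightarrow> ('b \<Rightarrow>\<^sub>0 'f) \<Rightarrow> 'v"
  where "lin_ext s T x = (\<Sum>u\<in>Poly_Mapping.keys x. s (Poly_Mapping.lookup x u) (T u))"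

context vector_space
begin

lemma lin_ext_superset:
  assumes "finite A" "Poly_Mapping.keys x \<subseteq> A"
  shows "lin_ext scale T x = (\<Sum>u\<in>A. Poly_Mapping.lookup x u *s T u)"
  unfolding lin_ext_def
  by (rule sum.mono_neutral_left) (use assms in \<open>auto simp: in_keys_iff\<close>)

lemma lin_ext_add: "lin_ext scale T (x + y) = lin_ext scale T x + lin_ext scale T y"
proof -
  let ?A = "Poly_Mapping.keys x \<union> Poly_Mapping.keys y"
  have "lin_ext scale T z = (\<Sum>u\<in>?A. Poly_Mapping.lookup z u *s T u)" if "Poly_Mapping.keys z \<subseteq> ?A" for z
    using that by (intro lin_ext_superset) auto
  then show ?thesis
    using keys_add[of x y] by (simp add: lookup_add scale_left_distrib sum.distrib)
qed

lemma lin_ext_single [simp]: "lin_ext scale T (Poly_Mapping.single u t) = t *s T u"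
  by (simp add: lin_ext_def)

lemma lin_ext_0 [simp]: "lin_ext scale T 0 = 0"
  by (simp add: lin_ext_def)

lemma lin_ext_uminus: "lin_ext scale T (- x) = - lin_ext scale T x"
  using lin_ext_add[of T x "- x"] by (simp add: minus_unique)

lemma lin_ext_diff: "lin_ext scale T (x - y) = lin_ext scale T x - lin_ext scale T y"
  using lin_ext_add[of T "x - y" y] by (simp add: eq_diff_eq)

lemma lin_ext_sum: "lin_ext scale T (sum g A) = (\<Sum>i\<in>A. lin_ext scale T (g i))"
  by (induction A rule: infinite_finite_induct) (simp_all add: lin_ext_add)

lemma lin_ext_scale: "lin_ext scale T (Defs.scale t x) = t *s lin_ext scale T x"
  by (induction x rule: poly_mapping_additive_induct)
    (simp_all add: lin_ext_add scale.scale_right_distrib scale_right_distrib)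

lemma lin_ext_sum_maps:
  "lin_ext scale (\<lambda>u. T u + T' u) x = lin_ext scale T x + lin_ext scale T' x"
  by (simp add: lin_ext_def scale_right_distrib sum.distrib)

lemma lin_ext_scale_maps: "lin_ext scale (\<lambda>u. t *s T u) x = t *s lin_ext scale T x"
  by (simp add: lin_ext_def scale_sum_right mult.commute)

end

lemma bilinear_ext_eq: "bilinear_ext m x y = lin_ext scale (\<lambda>u. lin_ext scale (m u) y) x"
  by (simp add: bilinear_ext_def lin_ext_def scale.scale_sum_right)

lemma bilinear_ext_add_left: "bilinear_ext m (x + x') y = bilinear_ext m x y + bilinear_ext m x' y"
  and bilinear_ext_add_right: "bilinear_ext m x (y + y') = bilinear_ext m x y + bilinear_ext m x y'"
  and bilinear_ext_scale_left: "bilinear_ext m (scale t x) y = scale t (bilinear_ext m x y)"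
  and bilinear_ext_scale_right: "bilinear_ext m x (scale t y) = scale t (bilinear_ext m x y)"
  and bilinear_ext_single:
    "bilinear_ext m (Poly_Mapping.single u s) (Poly_Mapping.single v t) = scale (s * t) (m u v)"
  by (simp_all add: bilinear_ext_eq scale.lin_ext_add scale.lin_ext_sum_maps scale.lin_ext_scale
      scale.lin_ext_scale_maps)

section \<open>The polynomial model\<close>

text \<open>Exponents of a, b, c, d in this order. They are added componentwise, so \<open>*\<close>
  is the commutative polynomial product; the noncommutative one is \<open>star\<close>.\<close>

type_synonym 'f pol = "nat \<times> nat \<times> nat \<times> nat \<Rightarrow>\<^sub>0 'f"

abbreviation monom :: "nat \<Rightarrow> nat \<Rightarrow> nat \<Rightarrow> nat \<Rightarrow> 'f \<Rightarrow> 'f::field pol"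
  where "monom i j k l t \<equiv> Poly_Mapping.single (i, j, k, l) t"

lemma monom_mult: "monom i j k l t * monom p q r s u = monom (i + p) (j + q) (k + r) (l + s) (t * u)"
  by (simp add: mult_single)

lemma monom_one [simp]: "monom 0 0 0 0 1 = 1"
  by (metis single_one zero_prod_def)

lemma pol_induct [case_names monom add]:
  assumes "\<And>i j k l t. P (monom i j k l t)" "\<And>x y. P x \<Longrightarrow> P y \<Longrightarrow> P (x + y)"
  shows "P x"
  by (induction x rule: poly_mapping_additive_induct) (use assms in auto)

section \<open>Derivations in a, b, d and the coefficients of c^0 and c^1\<close>

definition Da :: "'f::field pol \<Rightarrow> 'f pol"
  where "Da = lin_ext scale (\<lambda>(i, j, k, l). monom (i - 1) j k l (of_nat i))"
definition Db :: "'f::field pol \<Rightarrow> 'f pol"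
  where "Db = lin_ext scale (\<lambda>(i, j, k, l). monom i (j - 1) k l (of_nat j))"
definition Dd :: "'f::field pol \<Rightarrow> 'f pol"
  where "Dd = lin_ext scale (\<lambda>(i, j, k, l). monom i j k (l - 1) (of_nat l))"

text \<open>The e-component of a product depends on the operands only modulo c^2: the Kronecker
  deltas of the table select exponent 0 of c on the left and 0 or 1 on the right.\<close>

definition c0 :: "'f::field pol \<Rightarrow> 'f pol"
  where "c0 = lin_ext scale (\<lambda>(i, j, k, l). monom i j 0 l (of_bool (k = 0)))"
definition c1 :: "'f::field pol \<Rightarrow> 'f pol"
  where "c1 = lin_ext scale (\<lambda>(i, j, k, l). monom i j 0 l (of_bool (k = 1)))"

lemma Da_add: "Da (x + y) = Da x + Da y" and Db_add: "Db (x + y) = Db x + Db y"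
  and Dd_add: "Dd (x + y) = Dd x + Dd y" and c0_add: "c0 (x + y) = c0 x + c0 y"
  and c1_add: "c1 (x + y) = c1 x + c1 y"
  by (simp_all add: Da_def Db_def Dd_def c0_def c1_def scale.lin_ext_add)

lemma c0_diff: "c0 (x - y) = c0 x - c0 y" and c1_diff: "c1 (x - y) = c1 x - c1 y"
  by (simp_all add: c0_def c1_def scale.lin_ext_diff)

lemma Da_mono [simp]: "Da (monom i j k l t) = monom (i - 1) j k l (t * of_nat i)"
  and Db_mono [simp]: "Db (monom i j k l t) = monom i (j - 1) k l (t * of_nat j)"
  and Dd_mono [simp]: "Dd (monom i j k l t) = monom i j k (l - 1) (t * of_nat l)"
  and c0_mono [simp]: "c0 (monom i j k l t) = monom i j 0 l (t * of_bool (k = 0))"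
  and c1_mono [simp]: "c1 (monom i j k l t) = monom i j 0 l (t * of_bool (k = 1))"
  by (simp_all add: Da_def Db_def Dd_def c0_def c1_def)

lemma pol_mult_induct:
  assumes "\<And>i j k l t p q r s u. P (monom i j k l t) (monom p q r s u)"
    and "\<And>x x' y. P x y \<Longrightarrow> P x' y \<Longrightarrow> P (x + x') y"
    and "\<And>x y y'. P x y \<Longrightarrow> P x y' \<Longrightarrow> P x (y + y')"
  shows "P x y"
proof (induction x rule: pol_induct)
  case (monom i j k l t)
  show ?case by (induction y rule: pol_induct) (use assms in auto)
qed (use assms in auto)

lemma Da_mult: "Da (x * y) = Da x * y + x * Da y"
proof (induction x y rule: pol_mult_induct)
  case (1 i j k l t p q r s u)
  show ?case
    by (cases i; cases p) (simp_all add: monom_mult algebra_simps flip: single_add)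
qed (simp_all add: Da_add algebra_simps)

lemma Db_mult: "Db (x * y) = Db x * y + x * Db y"
proof (induction x y rule: pol_mult_induct)
  case (1 i j k l t p q r s u)
  show ?case
    by (cases j; cases q) (simp_all add: monom_mult algebra_simps flip: single_add)
qed (simp_all add: Db_add algebra_simps)

lemma Dd_mult: "Dd (x * y) = Dd x * y + x * Dd y"
proof (induction x y rule: pol_mult_induct)
  case (1 i j k l t p q r s u)
  show ?case
    by (cases l; cases s) (simp_all add: monom_mult algebra_simps flip: single_add)
qed (simp_all add: Dd_add algebra_simps)

lemma c0_mult: "c0 (x * y) = c0 x * c0 y"
  by (induction x y rule: pol_mult_induct) (simp_all add: monom_mult c0_add algebra_simps)

lemma c1_mult: "c1 (x * y) = c1 x * c0 y + c0 x * c1 y"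
proof (induction x y rule: pol_mult_induct)
  case (1 i j k l t p q r s u)
  show ?case
    by (cases "k = 0"; cases "r = 0") (simp_all add: monom_mult)
qed (simp_all add: c0_add c1_add algebra_simps)

lemma c0_Da: "c0 (Da x) = Da (c0 x)"
  by (induction x rule: pol_induct) (simp_all add: Da_add c0_add ac_simps)

definition mult_b :: "'f::field pol \<Rightarrow> 'f pol"
  where "mult_b h = monom 0 1 0 0 1 * h - monom 0 0 1 0 1 * Da h"

text \<open>
  Left multiplication by \<open>b\<close> is the operator \<open>b - c \<partial>\<^sub>a\<close>, so that \<open>ab - ba = c\<close>;
  the other variables multiply as in the polynomial ring.
\<close>

definition star :: "'f::field pol \<Rightarrow> 'f pol \<Rightarrow> 'f pol"
  where "star f h = lin_ext scale (\<lambda>(i, j, k, l). monom i 0 k l 1 * (mult_b ^^ j) h) f"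

lemma mult_b_add: "mult_b (x + y) = mult_b x + mult_b y"
  by (simp add: mult_b_def Da_add algebra_simps)

lemma mult_b_power_add: "(mult_b ^^ j) (x + y) = (mult_b ^^ j) x + (mult_b ^^ j) y"
  by (induction j) (simp_all add: mult_b_add)

lemma mult_b_mult: "mult_b (x * y) = x * mult_b y - monom 0 0 1 0 1 * Da x * y"
  by (simp add: mult_b_def Da_mult algebra_simps)

lemma mult_b_mono: "mult_b (monom p q r s t) = monom p (Suc q) r s t - monom (p - 1) q (Suc r) s (t * of_nat p)"
  by (simp add: mult_b_def monom_mult)

lemma star_add_left: "star (x + x') y = star x y + star x' y"
  by (simp add: star_def scale.lin_ext_add)

lemma star_diff_left: "star (x - x') y = star x y - star x' y"
  by (simp add: star_def scale.lin_ext_diff)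

lemma star_mono: "star (monom i j k l t) h = monom i 0 k l t * (mult_b ^^ j) h"
  by (simp add: star_def scale_mult_left)

lemma star_add_right: "star x (y + y') = star x y + star x y'"
  by (induction x rule: pol_induct)
    (simp_all add: star_mono mult_b_power_add star_add_left algebra_simps)

lemma star_mono_mult: "star (monom i 0 k l t * f) h = monom i 0 k l t * star f h"
proof (induction f rule: pol_induct)
  case (monom p q r s u)
  then show ?case
    by (simp add: monom_mult star_mono flip: mult.assoc)
qed (simp add: star_add_left algebra_simps)

text \<open>\<open>star f\<close> is the operator with normally ordered symbol f, all powers of
  \<open>mult_b\<close> standing on the right. For f = a^p b^q c^r d^s, moving \<open>mult_b\<close>
  past a^p costs - p a^(p-1) c by the product rule, and this is the second term of
  \<open>mult_b f\<close>.\<close>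

lemma star_mult_b: "star (mult_b f) h = mult_b (star f h)"
proof (induction f rule: pol_induct)
  case (monom p q r s t)
  show ?case
    by (simp add: mult_b_mono star_diff_left star_mono mult_b_mult monom_mult)
qed (simp add: star_add_left mult_b_add)

lemma star_mult_b_power: "star ((mult_b ^^ j) f) h = (mult_b ^^ j) (star f h)"
  by (induction j) (simp_all add: star_mult_b)

text \<open>\<open>star (star f g)\<close> is the composition of the operators \<open>star f\<close>
  and \<open>star g\<close>: the map from symbols to operators respects the two kinds of factors
  from which \<open>star f\<close> is built, monomials free of b and powers of
  \<open>mult_b\<close>.\<close>

lemma star_assoc: "star (star f g) h = star f (star g h)"
  by (induction f rule: pol_induct)
    (simp_all add: star_add_left star_mono star_mono_mult star_mult_b_power)

lemma c0_mult_b_power: "c0 ((mult_b ^^ j) h) = monom 0 j 0 0 1 * c0 h"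
proof (induction j)
  case 0
  show ?case by simp
next
  case (Suc j)
  then show ?case
    by (simp add: mult_b_def c0_diff c0_mult monom_mult flip: mult.assoc)
qed

lemma c0_star: "c0 (star f h) = c0 f * c0 h"
proof (induction f rule: pol_induct)
  case (monom i j k l t)
  show ?case
    by (simp add: star_mono c0_mult c0_mult_b_power monom_mult flip: mult.assoc)
qed (simp add: star_add_left c0_add algebra_simps)

lemma c1_mult_b_power:
  "c1 ((mult_b ^^ j) h) = monom 0 j 0 0 1 * c1 h - monom 0 (j - 1) 0 0 (of_nat j) * Da (c0 h)"
proof (induction j)
  case 0
  show ?case by simp
next
  case (Suc j)
  have "c1 (mult_b h') = monom 0 1 0 0 1 * c1 h' - Da (c0 h')" for h' :: "'a pol"
    by (simp add: mult_b_def c1_diff c1_mult c0_Da)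
  then have "c1 ((mult_b ^^ Suc j) h) = monom 0 1 0 0 1 * c1 ((mult_b ^^ j) h) - Da (c0 ((mult_b ^^ j) h))"
    by simp
  also have "\<dots> = monom 0 1 0 0 1 * (monom 0 j 0 0 1 * c1 h) - monom 0 1 0 0 1 * monom 0 (j - 1) 0 0 (of_nat j) * Da (c0 h)
       - monom 0 j 0 0 1 * Da (c0 h)"
    unfolding Suc.IH c0_mult_b_power by (simp add: Da_mult algebra_simps)
  also have "monom 0 1 0 0 1 * monom 0 (j - 1) 0 0 (of_nat j) = monom 0 j 0 0 (of_nat j :: 'a)"
    by (cases j) (simp_all add: monom_mult)
  finally show ?case
    by (simp add: monom_mult single_add algebra_simps flip: mult.assoc)
qed

text \<open>Modulo c^2, \<open>star\<close> is the commutative product with the first-order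
  correction - c (Db f)(Da h), the trace of ba = ab - c.\<close>

lemma c1_star: "c1 (star f h) = c1 f * c0 h + c0 f * c1 h - Db (c0 f) * Da (c0 h)"
proof (induction f rule: pol_induct)
  case (monom i j k l t)
  show ?case
    by (simp add: star_mono c1_mult c0_mult_b_power c1_mult_b_power monom_mult right_diff_distrib flip: mult.assoc)
qed (simp add: star_add_left c0_add c1_add Db_add algebra_simps)

text \<open>The integers 1, -1, 3, 2, -2, -6 are six times the table coefficients 1/6, -1/6, 1/2,
  1/3, -1/3, -1. \<open>H1\<close> is the c-coefficient of the right operand; its term records dc =
  cd - e, and there is none for the left operand because c already precedes d there.\<close>

definition cocycle :: "'f::field pol \<Rightarrow> 'f pol \<Rightarrow> 'f pol \<Rightarrow> 'f pol"
  where "cocycle F H H1 = scale (1/6) (Da (Db F) * Dd H - Da (Dd F) * Db H + 3 * Db (Dd F) * Da H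
    + 2 * Db F * Da (Dd H) - 2 * Dd F * Da (Db H) - 6 * Dd F * H1)"

text \<open>The pair (f, m) stands for f + m e. As c kills e, the factors acting on the second
  component are reduced by \<open>c0\<close>.\<close>

fun pair_mult :: "'f::field pol \<times> 'f pol \<Rightarrow> 'f pol \<times> 'f pol \<Rightarrow> 'f pol \<times> 'f pol"
  where "pair_mult (f, m) (g, n) = (star f g, c0 f * n + m * c0 g + cocycle (c0 f) (c0 g) (c1 g))"

definition jacobian_det :: "'f::field pol \<Rightarrow> 'f pol \<Rightarrow> 'f pol \<Rightarrow> 'f pol"
  where "jacobian_det F G H =
    Da F * (Db G * Dd H - Dd G * Db H) - Db F * (Da G * Dd H - Dd G * Da H) + Dd F * (Da G * Db H - Db G * Da H)"

text \<open>The third argument on the right is \<open>c1 (star g h)\<close> as computed by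
  \<open>c1_star\<close>. By the product rule only terms differentiating each of F, G, H exactly
  once survive; for instance Fd Gb Ha collects 3 + 2 - 6 = -1, its coefficient in the
  determinant.\<close>

lemma cocycle_coboundary:
  "cocycle F G G1 * H + cocycle (F * G) H H1
    = F * cocycle G H H1 + cocycle F (G * H) (G1 * H + G * H1 - Db G * Da H) + scale (1/6) (jacobian_det F G H)"
  by (simp add: cocycle_def jacobian_det_def scale_eq_mult Da_mult Db_mult Dd_mult Da_add Db_add Dd_add algebra_simps)

lemma pair_mult_assoc:
  "pair_mult (pair_mult x y) z = pair_mult x (pair_mult y z) + (0, scale (1/6) (jacobian_det (c0 (fst x)) (c0 (fst y)) (c0 (fst z))))"
proof -
  obtain f m g n h r where [simp]: "x = (f, m)" "y = (g, n)" "z = (h, r)"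
    by (cases x, cases y, cases z)
  show ?thesis
    using cocycle_coboundary[of "c0 f" "c0 g" "c1 g" "c0 h" "c1 h"]
    by (simp add: star_assoc c0_star c1_star algebra_simps)
qed

lemma pair_mult_left_alternative: "pair_mult (pair_mult x x) y = pair_mult x (pair_mult x y)"
  by (simp add: pair_mult_assoc jacobian_det_def algebra_simps flip: zero_prod_def)

lemma pair_mult_right_alternative: "pair_mult (pair_mult y x) x = pair_mult y (pair_mult x x)"
  by (simp add: pair_mult_assoc jacobian_det_def algebra_simps flip: zero_prod_def)

section \<open>The symbol algebra is alternative\<close>

definition pair_of1 :: "(symb \<Rightarrow>\<^sub>0 'f::field) \<Rightarrow> 'f pol"
  where "pair_of1 = lin_ext scale (\<lambda>u. case u of ABCD i j k l \<Rightarrow> monom i j k l 1 | ABDE i j l \<Rightarrow> 0)"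

text \<open>Since ce = 0, the second component uses only exponent 0 of c. The resulting map
  \<open>pair_of\<close> is injective but not onto, which suffices for pulling identities back to
  symbols.\<close>

definition pair_of2 :: "(symb \<Rightarrow>\<^sub>0 'f::field) \<Rightarrow> 'f pol"
  where "pair_of2 = lin_ext scale (\<lambda>u. case u of ABCD i j k l \<Rightarrow> 0 | ABDE i j l \<Rightarrow> monom i j 0 l 1)"

definition pair_of :: "(symb \<Rightarrow>\<^sub>0 'f::field) \<Rightarrow> 'f pol \<times> 'f pol"
  where "pair_of x = (pair_of1 x, pair_of2 x)"

lemma lookup_pair_of1: "Poly_Mapping.lookup (pair_of1 x) (i, j, k, l) = Poly_Mapping.lookup x (ABCD i j k l)"
proof (induction x rule: poly_mapping_additive_induct)
  case (single u t)
  show ?case by (cases u) (simp_all add: pair_of1_def lookup_single when_def)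
qed (simp add: pair_of1_def scale.lin_ext_add lookup_add)

lemma lookup_pair_of2: "Poly_Mapping.lookup (pair_of2 x) (i, j, 0, l) = Poly_Mapping.lookup x (ABDE i j l)"
proof (induction x rule: poly_mapping_additive_induct)
  case (single u t)
  show ?case by (cases u) (simp_all add: pair_of2_def lookup_single when_def)
qed (simp add: pair_of2_def scale.lin_ext_add lookup_add)

lemma pair_of_inject: "pair_of x = pair_of y \<Longrightarrow> x = y"
proof (rule poly_mapping_eqI)
  fix u assume "pair_of x = pair_of y"
  then have "pair_of1 x = pair_of1 y" "pair_of2 x = pair_of2 y"
    by (simp_all add: pair_of_def)
  then show "Poly_Mapping.lookup x u = Poly_Mapping.lookup y u"
    by (cases u) (metis lookup_pair_of1, metis lookup_pair_of2)
qed

text \<open>Binomial theorem for \<open>b - c \<partial>\<^sub>a\<close>: the two summands commute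
  as operators, and the \<mu>-th derivative of a^p is \<mu>! times the binomial coefficient of p
  over \<mu> times a^(p-\<mu>).\<close>

lemma mult_b_power_mono:
  "(mult_b ^^ j) (monom p q r s (t :: 'f::field)) =
    (\<Sum>\<mu> = 0..j. monom (p - \<mu>) (j + q - \<mu>) (r + \<mu>) s (t * ((- 1) ^ \<mu> * of_nat (fact \<mu> * (j choose \<mu>) * (p choose \<mu>)))))"
proof (induction j)
  case 0
  show ?case by simp
next
  case (Suc j)
  define C where "C j \<mu> = t * ((- 1) ^ \<mu> * of_nat (fact \<mu> * (j choose \<mu>) * (p choose \<mu>)))" for j \<mu>
  have mult_b_sum: "mult_b (sum g A) = (\<Sum>i\<in>A. mult_b (g i))" for g :: "nat \<Rightarrow> 'f pol" and A
    by (induction A rule: infinite_finite_induct) (simp_all add: mult_b_add, simp_all add: mult_b_def Da_def)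
  \<comment> \<open>Pascal's rule in j together with the absorption identity (\<mu>+1) C(p,\<mu>+1)
    = (p-\<mu>) C(p,\<mu>).\<close>
  have C_Suc: "C (Suc j) (Suc \<mu>) = C j (Suc \<mu>) - C j \<mu> * of_nat (p - \<mu>)" for \<mu>
  proof -
    have "Suc \<mu> * (p choose Suc \<mu>) = (p - \<mu>) * (p choose \<mu>)"
      by (metis binomial_absorb_comp binomial_absorption)
    then have *: "(of_nat (Suc \<mu>) :: 'f) * of_nat (p choose Suc \<mu>) = of_nat (p - \<mu>) * of_nat (p choose \<mu>)"
      by (metis of_nat_mult)
    have "C (Suc j) (Suc \<mu>) = C j (Suc \<mu>) - t * (- 1) ^ \<mu> * of_nat (fact \<mu>) * of_nat (j choose \<mu>) *
        (of_nat (Suc \<mu>) * of_nat (p choose Suc \<mu>))"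
      by (simp add: C_def algebra_simps)
    then show ?thesis
      unfolding * by (simp add: C_def algebra_simps)
  qed
  have "(mult_b ^^ Suc j) (monom p q r s t) =
      (\<Sum>\<mu> = 0..j. mult_b (monom (p - \<mu>) (j + q - \<mu>) (r + \<mu>) s (C j \<mu>)))"
    by (simp add: Suc.IH mult_b_sum C_def)
  also have "\<dots> = (\<Sum>\<mu> = 0..j. monom (p - \<mu>) (Suc j + q - \<mu>) (r + \<mu>) s (C j \<mu>))
      - (\<Sum>\<mu> = 0..j. monom (p - Suc \<mu>) (Suc j + q - Suc \<mu>) (r + Suc \<mu>) s (C j \<mu> * of_nat (p - \<mu>)))"
    by (simp add: mult_b_mono sum_subtractf Suc_diff_le)
  \<comment> \<open>The new summand \<mu> = j + 1 vanishes because \<open>j choose Suc j\<close> is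
    0.\<close>
  also have "(\<Sum>\<mu> = 0..j. monom (p - \<mu>) (Suc j + q - \<mu>) (r + \<mu>) s (C j \<mu>))
      = (\<Sum>\<mu> = 0..Suc j. monom (p - \<mu>) (Suc j + q - \<mu>) (r + \<mu>) s (C j \<mu>))"
    by (simp add: C_def binomial_eq_0)
  also have "\<dots> = monom p (Suc j + q) r s (C j 0) +
      (\<Sum>\<mu> = 0..j. monom (p - Suc \<mu>) (Suc j + q - Suc \<mu>) (r + Suc \<mu>) s (C j (Suc \<mu>)))"
    by (subst sum.atLeast0_atMost_Suc_shift) simp
  also have "\<dots> - (\<Sum>\<mu> = 0..j. monom (p - Suc \<mu>) (Suc j + q - Suc \<mu>) (r + Suc \<mu>) s (C j \<mu> * of_nat (p - \<mu>)))
      = monom p (Suc j + q) r s (C (Suc j) 0) +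
        (\<Sum>\<mu> = 0..j. monom (p - Suc \<mu>) (Suc j + q - Suc \<mu>) (r + Suc \<mu>) s (C (Suc j) (Suc \<mu>)))"
    by (simp add: C_Suc single_diff sum_subtractf, simp add: C_def)
  also have "\<dots> = (\<Sum>\<mu> = 0..Suc j. monom (p - \<mu>) (Suc j + q - \<mu>) (r + \<mu>) s (C (Suc j) \<mu>))"
    by (subst sum.atLeast0_atMost_Suc_shift) simp
  finally show ?case
    unfolding C_def .
qed

text \<open>The free coefficients u and v will be the indicators of r = 0 and r = 1, so one formula
  covers both Kronecker terms of the table.\<close>

lemma cocycle_mono:
  assumes "(6 :: 'f::field) \<noteq> 0"
  shows "cocycle (monom i j 0 l 1) (monom p q 0 s u) (monom p q 0 s v) =
     monom (i + p - 1) (j + q - 1) 0 (l + s - 1)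
         (u * (1/6 * of_nat (i * j * s) - 1/6 * of_nat (i * l * q) + 1/2 * of_nat (j * l * p)
             + 1/3 * of_nat (j * p * s) - 1/3 * of_nat (l * p * q) :: 'f))
     - monom (i + p) (j + q) 0 (l + s - 1) (of_nat l * v)"
proof -
  have eq: "monom i1 i2 i3 i4 w = monom j1 j2 j3 j4 w" if "w \<noteq> 0 \<Longrightarrow> i1 = j1 \<and> i2 = j2 \<and> i3 = j3 \<and> i4 = j4"
    for i1 i2 i3 i4 j1 j2 j3 j4 and w :: 'f
    using that by (cases "w = 0") auto
  let ?m = "monom (i + p - 1) (j + q - 1) 0 (l + s - 1) :: 'f \<Rightarrow> 'f pol"
  let ?i = "of_nat i :: 'f" and ?j = "of_nat j :: 'f" and ?l = "of_nat l :: 'f"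
    and ?p = "of_nat p :: 'f" and ?q = "of_nat q :: 'f" and ?s = "of_nat s :: 'f"
  let ?F = "monom i j 0 l 1" and ?H = "monom p q 0 s u" and ?H1 = "monom p q 0 s v"
  \<comment> \<open>When an exponent is 0, truncated subtraction can make the two monomials differ,
    but that exponent is also a factor of the coefficient; hence the case distinctions.\<close>
  have t: "Da (Db ?F) * Dd ?H = ?m (u * (?i * ?j * ?s))"
    "Da (Dd ?F) * Db ?H = ?m (u * (?i * ?l * ?q))"
    "Db (Dd ?F) * Da ?H = ?m (u * (?j * ?l * ?p))"
    "Db ?F * Da (Dd ?H) = ?m (u * (?j * ?p * ?s))"
    "Dd ?F * Da (Db ?H) = ?m (u * (?l * ?p * ?q))"
    "Dd ?F * ?H1 = monom (i + p) (j + q) 0 (l + s - 1) (?l * v)"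
    by (simp_all add: monom_mult ac_simps, (cases i; cases j; cases l; cases p; cases q; cases s; simp add: ac_simps)+)
  have n: "numeral k * monom i1 i2 i3 i4 w = monom i1 i2 i3 i4 (numeral k * w)" for k i1 i2 i3 i4 and w :: 'f
    by (simp add: zero_prod_def monom_mult flip: single_numeral)
  \<comment> \<open>All fractions of the table are written as integer multiples of 1/6, which is
    then kept opaque as \<open>w\<close>.\<close>
  have *: "(6::'f) = 2 * 3" by simp
  with assms have "(2::'f) \<noteq> 0" "(3::'f) \<noteq> 0" by (metis mult_zero_left, metis mult_zero_right)
  with * assms have halves: "1/2 = (3 * (1/6) :: 'f)" "1/3 = (2 * (1/6) :: 'f)" by (simp_all add: field_simps)
  define w :: 'f where "w = 1/6"
  have w: "w * (6 * x) = x" "w * (x * 6) = x" for x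
    using assms by (simp_all add: w_def)
  show ?thesis
    unfolding cocycle_def mult.assoc t n halves of_nat_mult w_def[symmetric]
    by (simp add: w flip: single_add single_diff) (simp add: algebra_simps w)
qed

lemma D_scale: "Da (scale t x) = scale t (Da x)" "Db (scale t x) = scale t (Db x)"
  "Dd (scale t x) = scale t (Dd x)" "c0 (scale t x) = scale t (c0 x)" "c1 (scale t x) = scale t (c1 x)"
  by (simp_all add: Da_def Db_def Dd_def c0_def c1_def scale.lin_ext_scale)

lemma mult_b_scale: "mult_b (scale t x) = scale t (mult_b x)"
  by (simp add: mult_b_def D_scale scale.scale_right_diff_distrib flip: scale_mult_right)

lemma star_scale_left: "star (scale t x) y = scale t (star x y)"
  by (simp add: star_def scale.lin_ext_scale)

lemma star_scale_right: "star x (scale t y) = scale t (star x y)"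
proof (induction x rule: pol_induct)
  case (monom i j k l u)
  have "(mult_b ^^ j) (scale t y) = scale t ((mult_b ^^ j) y)"
    by (induction j) (simp_all add: mult_b_scale)
  then show ?case
    by (simp add: star_mono scale_mult_right)
qed (simp add: star_add_left scale.scale_right_distrib)

lemma pair_mult_add_left: "pair_mult (x + x') y = pair_mult x y + pair_mult x' y"
  by (cases x; cases x'; cases y)
    (simp add: star_add_left c0_add Da_add Db_add Dd_add cocycle_def scale_eq_mult algebra_simps)

lemma pair_mult_add_right: "pair_mult x (y + y') = pair_mult x y + pair_mult x y'"
  by (cases x; cases y; cases y')
    (simp add: star_add_right c0_add c1_add Da_add Db_add Dd_add cocycle_def scale_eq_mult algebra_simps)

lemma pair_mult_scale: "pair_mult (scale t f, scale t m) (scale u g, scale u n) = map_prod (scale (t * u)) (scale (t * u)) (pair_mult (f, m) (g, n))"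
proof -
  have "scale (t * u) x = scale t (scale u x)" for x :: "'a pol"
    by simp
  then show ?thesis
    by (simp add: star_scale_left star_scale_right D_scale cocycle_def del: scale.scale_scale)
      (simp add: scale_eq_mult algebra_simps)
qed

lemma pair_of1_add: "pair_of1 (x + y) = pair_of1 x + pair_of1 y"
  and pair_of2_add: "pair_of2 (x + y) = pair_of2 x + pair_of2 y"
  by (simp_all add: pair_of1_def pair_of2_def scale.lin_ext_add)

lemma pair_of_add: "pair_of (x + y) = pair_of x + pair_of y"
  by (simp add: pair_of_def pair_of1_add pair_of2_add)

lemma pair_of_scale: "pair_of (scale t x) = map_prod (scale t) (scale t) (pair_of x)"
  by (simp add: pair_of_def pair_of1_def pair_of2_def scale.lin_ext_scale)

lemma pair_of_table:
  assumes "(6 :: 'f::field) \<noteq> 0"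
  shows "pair_of (symb_table u v) = pair_mult (pair_of (Poly_Mapping.single u 1)) (pair_of (Poly_Mapping.single v (1 :: 'f)))"
proof -
  have cocycle_0: "cocycle 0 H H1 = 0" "cocycle F 0 0 = 0" for F H H1 :: "'f pol"
    by (simp_all add: cocycle_def Da_def Db_def Dd_def)
  have star_0: "star x 0 = 0" "star 0 x = 0" for x :: "'f pol"
    using star_add_right[of x 0 0] by (simp_all add: star_def)
  have c_0: "c0 0 = (0 :: 'f pol)" "c1 0 = (0 :: 'f pol)"
    by (simp_all add: c0_def c1_def)
  show ?thesis
  proof (cases u)
    case u: (ABCD i j k l)
    show ?thesis
    proof (cases v)
      case v: (ABCD p q r s)
      have "(\<Sum>\<mu> = 0..j. monom (i + p - \<mu>) (j + q - \<mu>) (k + r + \<mu>) (l + s)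
          ((-1) ^ \<mu> * of_nat (fact \<mu> * (j choose \<mu>) * (p choose \<mu>)) :: 'f)) = star (monom i j k l 1) (monom p q r s 1)"
        unfolding star_mono mult_b_power_mono sum_distrib_left
      proof (rule sum.cong)
        \<comment> \<open>For \<mu> > p the exponents \<open>i + p - \<mu>\<close> and
          \<open>i + (p - \<mu>)\<close> may differ, but \<open>p choose \<mu>\<close> is then
          0.\<close>
        fix \<mu>
        show "monom (i + p - \<mu>) (j + q - \<mu>) (k + r + \<mu>) (l + s)
            ((-1) ^ \<mu> * of_nat (fact \<mu> * (j choose \<mu>) * (p choose \<mu>)) :: 'f) =
          monom i 0 k l 1 * monom (p - \<mu>) (j + q - \<mu>) (r + \<mu>) s
            (1 * ((- 1) ^ \<mu> * of_nat (fact \<mu> * (j choose \<mu>) * (p choose \<mu>))))"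
          by (cases "\<mu> \<le> p") (simp_all add: monom_mult binomial_eq_0 ac_simps)
      qed simp
      then have 1: "pair_of1 (symb_table u v) = star (monom i j k l 1) (monom p q r s (1 :: 'f))"
        by (simp add: u v pair_of1_def scale.lin_ext_add scale.lin_ext_diff scale.lin_ext_sum del: One_nat_def)
      \<comment> \<open>For k > 0 the reduction of the left operand modulo c is 0, and so are both
        the cocycle and the Kronecker deltas.\<close>
      have 2: "pair_of2 (symb_table u v) = cocycle (c0 (monom i j k l (1 :: 'f))) (c0 (monom p q r s 1)) (c1 (monom p q r s 1))"
      proof (cases "k = 0")
        case True
        then show ?thesis
          by (simp add: u v cocycle_mono[OF assms] pair_of2_def scale.lin_ext_add scale.lin_ext_diff
              scale.lin_ext_sum mult.commute del: One_nat_def)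
      next
        case False
        then show ?thesis
          by (simp add: u v cocycle_0 pair_of2_def scale.lin_ext_add scale.lin_ext_diff scale.lin_ext_sum)
      qed
      have "pair_of (Poly_Mapping.single (ABCD i j k l) (1 :: 'f)) = (monom i j k l 1, 0)" for i j k l
        by (simp add: pair_of_def pair_of1_def pair_of2_def)
      then show ?thesis
        unfolding u v pair_of_def[of "symb_table _ _"] 1[unfolded u v] 2[unfolded u v] by simp
    next
      case v: (ABDE p q s)
      show ?thesis
        by (simp add: u v pair_of_def pair_of1_def pair_of2_def star_0 c_0 cocycle_0 monom_mult)
    qed
  next
    case u: (ABDE i j l)
    show ?thesis
      by (cases v) (simp_all add: u pair_of_def pair_of1_def pair_of2_def star_0 c_0 cocycle_0 monom_mult)
  qed
qed

lemma pair_of_mult: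
  assumes "(6 :: 'f::field) \<noteq> 0"
  shows "pair_of (bilinear_ext symb_table x y) = pair_mult (pair_of x) (pair_of (y :: symb \<Rightarrow>\<^sub>0 'f))"
proof (induction x rule: poly_mapping_additive_induct)
  case (single u s)
  show ?case
  proof (induction y rule: poly_mapping_additive_induct)
    case (single v t)
    have *: "pair_of (Poly_Mapping.single u s) = map_prod (scale s) (scale s) (pair_of (Poly_Mapping.single u 1))"
      for u :: symb and s :: 'f
      by (simp flip: pair_of_scale)
    obtain f m g n where "pair_of (Poly_Mapping.single u (1 :: 'f)) = (f, m)" "pair_of (Poly_Mapping.single v (1 :: 'f)) = (g, n)"
      by fastforce
    then show ?case
      unfolding *[of _ s] *[of _ t]
      by (simp add: bilinear_ext_single pair_of_scale pair_of_table[OF assms] pair_mult_scale del: pair_mult.simps)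
  qed (simp add: bilinear_ext_add_right pair_of_add pair_mult_add_right)
qed (simp add: bilinear_ext_add_left pair_of_add pair_mult_add_left)

lemma symb_left_alternative:
  fixes x y :: "symb \<Rightarrow>\<^sub>0 'f::field"
  assumes "(6 :: 'f) \<noteq> 0"
  shows "bilinear_ext symb_table (bilinear_ext symb_table x x) y = bilinear_ext symb_table x (bilinear_ext symb_table x y)"
  by (rule pair_of_inject) (simp only: pair_of_mult[OF assms] pair_mult_left_alternative)

lemma symb_right_alternative:
  fixes x y :: "symb \<Rightarrow>\<^sub>0 'f::field"
  assumes "(6 :: 'f) \<noteq> 0"
  shows "bilinear_ext symb_table (bilinear_ext symb_table y x) x = bilinear_ext symb_table y (bilinear_ext symb_table x x)"
  by (rule pair_of_inject) (simp only: pair_of_mult[OF assms] pair_mult_right_alternative)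

section \<open>Alternative algebras\<close>

locale nonassociative_algebra = vector_space scl
  for scl :: "'b::field \<Rightarrow> 'a::ab_group_add \<Rightarrow> 'a" (infixr \<open>*s\<close> 75) +
  fixes mul :: "'a \<Rightarrow> 'a \<Rightarrow> 'a" (infixl \<open>\<cdot>\<close> 70) and unit :: 'a
  assumes mul_add_left: "(x + y) \<cdot> z = x \<cdot> z + y \<cdot> z"
    and mul_add_right: "x \<cdot> (y + z) = x \<cdot> y + x \<cdot> z"
    and mul_scale_left: "(t *s x) \<cdot> y = t *s (x \<cdot> y)"
    and mul_scale_right: "x \<cdot> (t *s y) = t *s (x \<cdot> y)"
    and unit_left [simp]: "unit \<cdot> x = x"
    and unit_right [simp]: "x \<cdot> unit = x"
begin

definition assoc :: "'a \<Rightarrow> 'a \<Rightarrow> 'a \<Rightarrow> 'a"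
  where "assoc x y z = (x \<cdot> y) \<cdot> z - x \<cdot> (y \<cdot> z)"

definition comm :: "'a \<Rightarrow> 'a \<Rightarrow> 'a"
  where "comm x y = x \<cdot> y - y \<cdot> x"

lemma mul_zero_left [simp]: "0 \<cdot> x = 0"
  using mul_add_left[of 0 0 x] by simp

lemma mul_zero_right [simp]: "x \<cdot> 0 = 0"
  using mul_add_right[of x 0 0] by simp

lemma mul_minus_left: "(- x) \<cdot> y = - (x \<cdot> y)"
  using mul_add_left[of x "- x" y] by (simp add: minus_unique)

lemma mul_minus_right: "x \<cdot> (- y) = - (x \<cdot> y)"
  using mul_add_right[of x y "- y"] by (simp add: minus_unique)

lemma mul_diff_left: "(x - y) \<cdot> z = x \<cdot> z - y \<cdot> z"
  using mul_add_left[of "x - y" y z] by (simp add: eq_diff_eq)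

lemma mul_diff_right: "x \<cdot> (y - z) = x \<cdot> y - x \<cdot> z"
  using mul_add_right[of x "y - z" z] by (simp add: eq_diff_eq)

lemmas mul_simps = mul_add_left mul_add_right mul_minus_left mul_minus_right
  mul_diff_left mul_diff_right mul_scale_left mul_scale_right

lemma assoc_add: "assoc (x + x') y z = assoc x y z + assoc x' y z"
  "assoc x (y + y') z = assoc x y z + assoc x y' z"
  "assoc x y (z + z') = assoc x y z + assoc x y z'"
  by (simp_all add: assoc_def mul_simps algebra_simps)

lemma assoc_scale: "assoc (t *s x) y z = t *s assoc x y z"
  "assoc x (t *s y) z = t *s assoc x y z"
  "assoc x y (t *s z) = t *s assoc x y z"
  by (simp_all add: assoc_def mul_simps scale_right_diff_distrib)

lemma assoc_minus: "assoc (- x) y z = - assoc x y z"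
  "assoc x (- y) z = - assoc x y z"
  "assoc x y (- z) = - assoc x y z"
  by (simp_all add: assoc_def mul_simps)

lemma assoc_diff: "assoc (x - x') y z = assoc x y z - assoc x' y z"
  "assoc x (y - y') z = assoc x y z - assoc x y' z"
  "assoc x y (z - z') = assoc x y z - assoc x y z'"
  by (simp_all add: assoc_def mul_simps algebra_simps)

lemma assoc_zero [simp]: "assoc 0 y z = 0" "assoc x 0 z = 0" "assoc x y 0 = 0"
  by (simp_all add: assoc_def)

lemma assoc_unit [simp]: "assoc x y unit = 0"
  by (simp add: assoc_def)

lemma comm_minus: "comm (- x) y = - comm x y"
  by (simp add: comm_def mul_simps)

lemma comm_zero [simp]: "comm 0 y = 0" "comm y 0 = 0"
  by (simp_all add: comm_def)

lemma comm_swap: "comm y x = - comm x y"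
  by (simp add: comm_def)

lemma teichmueller:
  "assoc (w \<cdot> x) y z - assoc w (x \<cdot> y) z + assoc w x (y \<cdot> z) = w \<cdot> assoc x y z + assoc w x y \<cdot> z"
  by (simp add: assoc_def mul_simps algebra_simps)

end

locale alternative_algebra = nonassociative_algebra +
  assumes left_alternative: "assoc x x y = 0"
    and right_alternative: "assoc y x x = 0"
begin

lemma assoc_swap12: "assoc y x z = - assoc x y z"
proof -
  have "assoc (x + y) (x + y) z = assoc x x z + assoc x y z + assoc y x z + assoc y y z"
    by (simp only: assoc_add ac_simps)
  then have "assoc x y z + assoc y x z = 0"
    by (simp add: left_alternative)
  then show ?thesis
    by (simp add: add.commute eq_neg_iff_add_eq_0)
qed

lemma assoc_swap23: "assoc x z y = - assoc x y z"
proof -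
  have "assoc x (y + z) (y + z) = assoc x y y + assoc x y z + assoc x z y + assoc x z z"
    by (simp only: assoc_add ac_simps)
  then have "assoc x y z + assoc x z y = 0"
    by (simp add: right_alternative)
  then show ?thesis
    by (simp add: add.commute eq_neg_iff_add_eq_0)
qed

lemma assoc_0_swap23: "assoc x y z = 0 \<Longrightarrow> assoc x z y = 0"
  by (simp add: assoc_swap23[of x z y])

lemma assoc_cyclic: "assoc y z x = assoc x y z"
  using assoc_swap12[of x y z] assoc_swap23[of y x z] by simp

lemma flexible: "assoc x y x = 0"
  using assoc_swap23[of x y x] left_alternative by simp

text \<open>Two instances of the Teichmueller identity with f repeated each contain (g,ff,y) -
  (g,f,fy); eliminating this difference leaves the claim.\<close>

lemma moufang_left: "assoc (g \<cdot> f) f y = f \<cdot> assoc g f y"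
proof -
  have 1: "assoc (g \<cdot> f) f y - assoc g (f \<cdot> f) y + assoc g f (f \<cdot> y) = 0"
    using teichmueller[of g f f y] by (simp add: left_alternative right_alternative)
  have 2: "assoc g (f \<cdot> f) y - assoc g f (f \<cdot> y) = f \<cdot> assoc g f y"
    using teichmueller[of f f y g]
    by (simp add: left_alternative assoc_cyclic[where x = g])
  from 1 have "assoc (g \<cdot> f) f y = assoc g (f \<cdot> f) y - assoc g f (f \<cdot> y)"
    by (simp add: algebra_simps add_eq_0_iff)
  with 2 show ?thesis by simp
qed

lemma moufang_left_linearized:
  "assoc (g \<cdot> h) f y + assoc (g \<cdot> f) h y = f \<cdot> assoc g h y + h \<cdot> assoc g f y"
  using moufang_left[of g "f + h" y] moufang_left[of g f y] moufang_left[of g h y]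
  by (simp add: mul_simps assoc_add algebra_simps)

text \<open>Expand by the Teichmueller identity and replace f(g,h,y) by the linearized Moufang
  identity. The terms (f,gh,y) and (gh,f,y) cancel by skew-symmetry, while (fg,h,y) and (gf,h,y)
  combine to the commutator.\<close>

lemma assoc_mul_left:
  "assoc f g (h \<cdot> y) = h \<cdot> assoc f g y + assoc f g h \<cdot> y - assoc (comm f g) h y"
proof -
  have t: "assoc f g (h \<cdot> y) =
      f \<cdot> assoc g h y + assoc f g h \<cdot> y - assoc (f \<cdot> g) h y + assoc f (g \<cdot> h) y"
    using teichmueller[of f g h y] by (simp add: algebra_simps)
  have "f \<cdot> assoc g h y = assoc (g \<cdot> h) f y + assoc (g \<cdot> f) h y - h \<cdot> assoc g f y"
    using moufang_left_linearized[of g h f y] by (simp add: algebra_simps)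
  then show ?thesis
    unfolding t
    by (simp add: comm_def assoc_diff assoc_swap12[of f "g \<cdot> h" y] assoc_swap12[of f g y] mul_simps algebra_simps)
qed

lemma opposite: "alternative_algebra scl (\<lambda>x y. y \<cdot> x) unit"
proof -
  interpret op: nonassociative_algebra scl "\<lambda>x y. y \<cdot> x" unit
    by unfold_locales (simp_all add: mul_simps)
  have "op.assoc x y z = - assoc z y x" for x y z
    by (simp add: op.assoc_def assoc_def)
  then show ?thesis
    by unfold_locales (simp_all add: left_alternative right_alternative)
qed

text \<open>Passing to the opposite product reverses the arguments and changes the sign; the
  reversal is an odd permutation, so the signs cancel. Every left-hand identity thus yields a
  right-hand one with the same associators.\<close>

lemma opposite_assoc: "nonassociative_algebra.assoc (\<lambda>x y. y \<cdot> x) x y z = assoc x y z"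
proof -
  interpret op: alternative_algebra scl "\<lambda>x y. y \<cdot> x" unit by (rule opposite)
  have "op.assoc x y z = - assoc z y x"
    by (simp add: op.assoc_def assoc_def)
  then show ?thesis
    using assoc_swap12[of y z x] assoc_cyclic by simp
qed

lemma moufang_right: "assoc (f \<cdot> g) f y = assoc g f y \<cdot> f"
proof -
  interpret op: alternative_algebra scl "\<lambda>x y. y \<cdot> x" unit by (rule opposite)
  show ?thesis
    using op.moufang_left[where f = f and g = g and y = y] by (simp add: opposite_assoc)
qed

lemma assoc_mul_right:
  "assoc f g (y \<cdot> h) = assoc f g y \<cdot> h + y \<cdot> assoc f g h + assoc (comm f g) h y"
proof -
  interpret op: alternative_algebra scl "\<lambda>x y. y \<cdot> x" unit by (rule opposite)
  have "op.comm f g = - comm f g"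
    by (simp add: op.comm_def comm_def)
  then show ?thesis
    using op.assoc_mul_left[where f = f and g = g and h = h and y = y] by (simp add: opposite_assoc assoc_minus)
qed

text \<open>The sum expands into six signed associators, one for each permutation of x, y, z, and
  skew-symmetry makes them all equal. Dividing by 6 turns commutator data into associator
  data.\<close>

lemma jacobian: "comm (comm x y) z + comm (comm y z) x + comm (comm z x) y = 6 *s assoc x y z"
proof -
  have "comm (comm x y) z + comm (comm y z) x + comm (comm z x) y =
      assoc x y z + assoc y z x + assoc z x y - assoc y x z - assoc x z y - assoc z y x"
    by (simp add: comm_def assoc_def mul_simps algebra_simps)
  also have "\<dots> = assoc x y z + assoc x y z + assoc x y z + assoc x y z + assoc x y z + assoc x y z"
    using assoc_cyclic[of x y z] assoc_cyclic[of y z x] assoc_cyclic[of y x z] assoc_swap12[of x y z]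
      assoc_swap23[of x y z] assoc_swap12[of y z x]
    by simp
  also have "\<dots> = 6 *s assoc x y z"
    proof -
    have "6 *s assoc x y z = (1 + 1 + 1 + 1 + 1 + 1) *s assoc x y z" by simp
    then show ?thesis by (simp only: scale_left_distrib scale_one)
  qed
  finally show ?thesis .
qed

text \<open>The reordering rule for left multiplications: a swap costs a commutator and, since the
  associator is skew, the same associator twice.\<close>

lemma mul_commute_left: "g \<cdot> (f \<cdot> x) = f \<cdot> (g \<cdot> x) + assoc f g x + assoc f g x - comm f g \<cdot> x"
  using assoc_swap12[of f g x] by (simp add: assoc_def comm_def mul_simps algebra_simps)

end


section \<open>Alternative algebras generated by the Malcev algebra\<close>

text \<open>The assumption \<open>generated\<close> says that no proper unital subalgebra contains
  the generators, and serves as an induction principle.\<close>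

locale malcev_envelope = alternative_algebra scl mul unit
  for scl :: "'f::field \<Rightarrow> 'a::ab_group_add \<Rightarrow> 'a" (infixr \<open>*s\<close> 75)
    and mul (infixl \<open>\<cdot>\<close> 70) and unit +
  fixes a b c d e :: 'a
  assumes six: "(6::'f) \<noteq> 0"
    and comm_ab: "comm a b = c" and comm_ac: "comm a c = 0" and comm_ad: "comm a d = 0"
    and comm_ae: "comm a e = 0" and comm_bc: "comm b c = 0" and comm_bd: "comm b d = 0"
    and comm_be: "comm b e = 0" and comm_cd: "comm c d = e" and comm_ce: "comm c e = 0"
    and comm_de: "comm d e = 0"
    and generated: "\<lbrakk>subspace S; unit \<in> S; {a, b, c, d, e} \<subseteq> S; \<And>x y. \<lbrakk>x \<in> S; y \<in> S\<rbrakk> \<Longrightarrow> x \<cdot> y \<in> S\<rbrakk>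
          \<Longrightarrow> S = UNIV"
begin

section \<open>Commutators and associators of the generators\<close>

definition gens where "gens = {a, b, c, d, e}"

lemma gens_cases [consumes 1]:
  assumes "g \<in> gens" obtains "g = a" | "g = b" | "g = c" | "g = d" | "g = e"
  using assms unfolding gens_def by blast

lemma gens_simps [simp]: "a \<in> gens" "b \<in> gens" "c \<in> gens" "d \<in> gens" "e \<in> gens"
  by (simp_all add: gens_def)

lemma comm_self [simp]: "comm x x = 0"
  by (simp add: comm_def)

lemmas comm_table = comm_ab comm_ac comm_ad comm_ae comm_bc comm_bd comm_be comm_cd comm_ce comm_de
  comm_ab[THEN arg_cong[of _ _ uminus], folded comm_swap]
  comm_ac[THEN arg_cong[of _ _ uminus], folded comm_swap]
  comm_ad[THEN arg_cong[of _ _ uminus], folded comm_swap]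
  comm_ae[THEN arg_cong[of _ _ uminus], folded comm_swap]
  comm_bc[THEN arg_cong[of _ _ uminus], folded comm_swap]
  comm_bd[THEN arg_cong[of _ _ uminus], folded comm_swap]
  comm_be[THEN arg_cong[of _ _ uminus], folded comm_swap]
  comm_cd[THEN arg_cong[of _ _ uminus], folded comm_swap]
  comm_ce[THEN arg_cong[of _ _ uminus], folded comm_swap]
  comm_de[THEN arg_cong[of _ _ uminus], folded comm_swap]

lemma comm_gens:
  assumes "f \<in> gens" "g \<in> gens"
  shows "comm f g = 0 \<or> comm f g = c \<or> comm f g = - c \<or> comm f g = e \<or> comm f g = - e"
  using assms by (elim gens_cases) (simp_all add: comm_table)

lemma comm_gens_e: "f \<in> gens \<Longrightarrow> comm f e = 0" "f \<in> gens \<Longrightarrow> comm e f = 0"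
  by (erule gens_cases; simp add: comm_table)+

lemma comm_gens_c:
  "f \<in> gens \<Longrightarrow> comm c f = 0 \<or> comm c f = e \<or> comm c f = - e"
  by (erule gens_cases; simp add: comm_table)+

lemma comm_comm_c:
  assumes "f \<in> gens" "g \<in> gens" shows "comm (comm f g) c = 0" "comm (comm f g) e = 0"
  using comm_gens[OF assms] by (elim disjE; simp add: comm_table comm_minus)+

lemma assoc_eq_0_if_jacobian:
  assumes "comm (comm x y) z + comm (comm y z) x + comm (comm z x) y = 0"
  shows "assoc x y z = 0"
  using assms six jacobian[of x y z] by simp

lemma assoc_e_gens: "f \<in> gens \<Longrightarrow> g \<in> gens \<Longrightarrow> assoc e f g = 0"
  by (rule assoc_eq_0_if_jacobian) (simp add: comm_gens_e comm_comm_c)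

text \<open>Each Jacobi summand is 0: [c,f] is 0 or e up to sign, e commutes with the generators,
  and [f,g] is 0, c or e up to sign, hence commutes with c.\<close>

lemma assoc_c_gens:
  assumes "f \<in> gens" "g \<in> gens" shows "assoc c f g = 0"
proof (rule assoc_eq_0_if_jacobian)
  have 1: "comm (comm c f) g = 0"
    using comm_gens_c[OF assms(1)] assms by (elim disjE) (simp_all add: comm_minus comm_gens_e)
  have "comm g c = - comm c g"
    by (rule comm_swap)
  then have 2: "comm (comm g c) f = 0"
    using comm_gens_c[OF assms(2)] assms by (elim disjE) (simp_all add: comm_minus comm_gens_e)
  show "comm (comm c f) g + comm (comm f g) c + comm (comm g c) f = 0"
    using 1 2 assms by (simp add: comm_comm_c)
qed

lemma assoc_gens:
  assumes "f \<in> gens" "g \<in> gens" "h \<in> gens"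
  shows "\<exists>t. assoc f g h = t *s e"
proof -
  have *: "\<exists>t. comm (comm f g) h = t *s e" if "f \<in> gens" "g \<in> gens" "h \<in> gens" for f g h
  proof -
    have "comm (comm f g) h = 0 \<or> comm (comm f g) h = e \<or> comm (comm f g) h = - e"
      using comm_gens[OF that(1,2)] comm_gens_c[OF that(3)] comm_gens_e[OF that(3)]
      by (auto simp: comm_minus)
    then show ?thesis
      by (metis scale_zero_left scale_one scale_minus_left)
  qed
  obtain t1 t2 t3 where "comm (comm f g) h = t1 *s e" "comm (comm g h) f = t2 *s e"
    "comm (comm h f) g = t3 *s e"
    using *[OF assms(1,2,3)] *[OF assms(2,3,1)] *[OF assms(3,1,2)] by blast
  then have "6 *s assoc f g h = (t1 + t2 + t3) *s e"
    unfolding jacobian[symmetric] by (simp add: scale_left_distrib)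
  then have "(1/6) *s 6 *s assoc f g h = (1/6) *s (t1 + t2 + t3) *s e"
    by simp
  then have "assoc f g h = ((1/6) * (t1 + t2 + t3)) *s e"
    using six by simp
  then show ?thesis ..
qed

lemma assoc_abd: "6 *s assoc a b d = e"
  unfolding jacobian[symmetric] by (simp add: comm_table)

text \<open>Induction over one-sided multiplications by single generators instead of arbitrary
  products. The least set \<open>W\<close> closed under them is a subalgebra: the v in
  \<open>W\<close> with vW contained in \<open>W\<close> form a set with the same closure
  properties, which is all of \<open>W\<close> by minimality.\<close>

lemma operator_generated:
  assumes S: "subspace S" "unit \<in> S"
    and cl: "\<And>f x. \<lbrakk>f \<in> gens; x \<in> S\<rbrakk> \<Longrightarrow> f \<cdot> x \<in> S" "\<And>f x. \<lbrakk>f \<in> gens; x \<in> S\<rbrakk> \<Longrightarrow> x \<cdot> f \<in> S"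
  shows "x \<in> S"
proof -
  define good where "good S \<longleftrightarrow> subspace S \<and> unit \<in> S \<and> (\<forall>f\<in>gens. \<forall>x\<in>S. f \<cdot> x \<in> S \<and> x \<cdot> f \<in> S)" for S
  define W where "W = \<Inter>{S. good S}"
  have W: "good W"
    unfolding good_def W_def by (auto intro!: subspace_Inter)
  have W_min: "W \<subseteq> U" if "good U" for U
    using that by (auto simp: W_def)
  have "good {v \<in> W. \<forall>x\<in>W. v \<cdot> x \<in> W}" (is "good ?U")
    unfolding good_def
  proof (intro conjI ballI)
    show "subspace ?U"
      using W unfolding good_def subspace_def by (auto simp: mul_simps)
    show "unit \<in> ?U"
      using W by (auto simp: good_def)
    fix f v assume f: "f \<in> gens" and v: "v \<in> ?U"
    have W_diff: "x - y \<in> W" if "x \<in> W" "y \<in> W" for x y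
      using that W by (auto simp: good_def intro: subspace_diff)
    have W_add: "x + y \<in> W" if "x \<in> W" "y \<in> W" for x y
      using that W by (auto simp: good_def intro: subspace_add)
    have W_f: "f \<cdot> x \<in> W" "x \<cdot> f \<in> W" if "x \<in> W" for x
      using that f W by (auto simp: good_def)
    \<comment> \<open>By (f,v,x) = (v,x,f), multiplication by fv is expressed through
      multiplications by f on either side and by v, all of which preserve \<open>W\<close>.\<close>
    have "(f \<cdot> v) \<cdot> x = f \<cdot> (v \<cdot> x) + ((v \<cdot> x) \<cdot> f - v \<cdot> (x \<cdot> f))" for x
      using assoc_cyclic[where x = f and y = v and z = x] by (simp add: assoc_def algebra_simps)
    then show "f \<cdot> v \<in> ?U"
      using v by (auto intro!: W_add W_diff W_f)
    have "(v \<cdot> f) \<cdot> x = v \<cdot> (f \<cdot> x) - ((v \<cdot> x) \<cdot> f - v \<cdot> (x \<cdot> f))" for x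
      using assoc_swap23[where x = v and y = f and z = x] by (simp add: assoc_def algebra_simps)
    then show "v \<cdot> f \<in> ?U"
      using v by (auto intro!: W_add W_diff W_f)
  qed
  then have "W \<subseteq> ?U"
    by (rule W_min)
  then have prod: "x \<cdot> y \<in> W" if "x \<in> W" "y \<in> W" for x y
    using that by blast
  have "f \<in> W" if "f \<in> gens" for f
    using W that unfolding good_def by (metis unit_right)
  then have "{a, b, c, d, e} \<subseteq> W"
    by (auto simp: gens_def)
  then have "W = UNIV"
    using W prod by (intro generated) (auto simp: good_def)
  moreover have "W \<subseteq> S"
    using S cl by (intro W_min) (auto simp: good_def)
  ultimately show ?thesis
    by blast
qed

text \<open>In \<open>assoc_mul_left\<close> and \<open>assoc_mul_right\<close> the correction
  contains [e,f] = 0, so vanishing on the generators propagates to all x.\<close>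

lemma assoc_e:
  assumes "f \<in> gens" shows "assoc e f x = 0"
proof -
  have "x \<in> {x. assoc e f x = 0}"
  proof (rule operator_generated)
    show "subspace {x. assoc e f x = 0}"
      by (auto simp: subspace_def assoc_add assoc_scale)
  qed (use assms in \<open>auto simp: assoc_mul_left assoc_mul_right comm_gens_e assoc_e_gens\<close>)
  then show ?thesis by simp
qed

text \<open>Here the correction contains [c,f], which is 0 or e up to sign, and is therefore removed
  by \<open>assoc_e\<close>.\<close>

lemma assoc_c:
  assumes "f \<in> gens" shows "assoc c f x = 0"
proof -
  have *: "assoc (comm c f) g x = 0" if "g \<in> gens" for g x
    using comm_gens_c[OF assms] that by (elim disjE) (simp_all add: assoc_e assoc_minus)
  have "x \<in> {x. assoc c f x = 0}"
  proof (rule operator_generated)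
    show "subspace {x. assoc c f x = 0}"
      by (auto simp: subspace_def assoc_add assoc_scale)
  qed (use assms in \<open>auto simp: assoc_mul_left assoc_mul_right * assoc_c_gens *[THEN assoc_0_swap23]\<close>)
  then show ?thesis by simp
qed

text \<open>This removes the correction term of \<open>assoc_mul_left\<close>: for generators f, g,
  h it becomes the product rule (f,g,hx) = h(f,g,x) + (f,g,h)x.\<close>

lemma assoc_comm_gens:
  assumes "f \<in> gens" "g \<in> gens" "h \<in> gens" shows "assoc (comm f g) h x = 0"
  using comm_gens[OF assms(1,2)] assms(3) by (elim disjE) (simp_all add: assoc_c assoc_e assoc_minus)

lemma e_left_commute:
  assumes "f \<in> gens" shows "e \<cdot> (f \<cdot> x) = f \<cdot> (e \<cdot> x)"
  using mul_commute_left[of e f x] assoc_e[OF assms, of x] assms assoc_swap12[of e f x]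
  by (simp add: comm_gens_e)

lemma e_commute: "e \<cdot> x = x \<cdot> e"
proof -
  have assoc_e': "assoc f x e = 0" "assoc x f e = 0" "assoc e x f = 0" if "f \<in> gens" for f x
    using assoc_e[OF that, of x] assoc_cyclic[where x = e and y = f and z = x]
      assoc_swap12[of f x e] assoc_swap23[of e f x] by simp_all
  have "x \<in> {x. e \<cdot> x = x \<cdot> e}"
  proof (rule operator_generated)
    show "subspace {x. e \<cdot> x = x \<cdot> e}"
      by (auto simp: subspace_def mul_simps)
  next
    fix f x assume f: "f \<in> gens" and x: "x \<in> {x. e \<cdot> x = x \<cdot> e}"
    have "e \<cdot> (f \<cdot> x) = f \<cdot> (e \<cdot> x)"
      using f by (rule e_left_commute)
    also have "\<dots> = (f \<cdot> x) \<cdot> e"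
      using assoc_e'(1)[OF f, of x] x by (simp add: assoc_def)
    finally show "f \<cdot> x \<in> {x. e \<cdot> x = x \<cdot> e}" by simp
    have "e \<cdot> (x \<cdot> f) = (e \<cdot> x) \<cdot> f"
      using assoc_e'(3)[OF f, of x] by (simp add: assoc_def)
    also have "\<dots> = (x \<cdot> e) \<cdot> f"
      using x by simp
    also have "\<dots> = x \<cdot> (e \<cdot> f)"
      using assoc_e'(2)[OF f, of x] assoc_swap23[of x f e] by (simp add: assoc_def)
    also have "e \<cdot> f = f \<cdot> e"
      using comm_gens_e(2)[OF f] by (simp add: comm_def)
    also have "x \<cdot> (f \<cdot> e) = (x \<cdot> f) \<cdot> e"
      using assoc_e'(2)[OF f, of x] by (simp add: assoc_def)
    finally show "x \<cdot> f \<in> {x. e \<cdot> x = x \<cdot> e}" by simp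
  qed simp
  then show ?thesis by simp
qed

text \<open>
  The identities \<open>a(a,b,x) = (a,b,ax) = (a,b,x)a\<close> and the same for \<open>b\<close> hold because
  \<open>(c,a,x) = (c,b,x) = 0\<close>; for \<open>x = d\<close> they show that \<open>ab\<close> and \<open>ba\<close> multiply \<open>(a,b,d)\<close> in the same way.
\<close>
lemma c_mul_e: "c \<cdot> e = 0"
proof -
  define y where "y = assoc a b d"
  have e: "e = 6 *s y"
    using assoc_abd by (simp add: y_def)
  have D: "f \<cdot> assoc a b x = assoc a b x \<cdot> f" if "f = a \<or> f = b" for f x
  proof -
    have "assoc a b (f \<cdot> x) = assoc a b x \<cdot> f"
    proof (cases "f = a")
      case True
      then show ?thesis
        using moufang_right[where f = a and g = x and y = b] assoc_cyclic[where x = "a \<cdot> x" and y = a and z = b]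
          assoc_cyclic[where x = x and y = a and z = b] by simp
    next
      case False
      then have "f = b" using that by simp
      then show ?thesis
        using moufang_right[where f = b and g = x and y = a] assoc_cyclic[where x = "b \<cdot> x" and y = a and z = b]
          assoc_cyclic[where x = x and y = a and z = b]
          assoc_swap23[of "b \<cdot> x" b a] assoc_swap23[of x b a] by (simp add: mul_minus_left)
    qed
    moreover have "assoc a b (f \<cdot> x) = f \<cdot> assoc a b x"
      using that flexible[of a b] right_alternative[of a b] by (auto simp: assoc_mul_left assoc_comm_gens)
    ultimately show ?thesis by simp
  qed
  \<comment> \<open>This exhibits by as another value of (a,b,.), so that \<open>D\<close> allows a
    to pass it as well.\<close>
  have b: "b \<cdot> y = assoc a b (b \<cdot> d)"
    by (simp add: y_def assoc_mul_left assoc_comm_gens right_alternative)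
  \<comment> \<open>Rewriting a(by) as (yb)a leaves -(a,b,y) on both sides, so (ab)y = y(ba). As e
    is a multiple of y and central, [a,b]e = 0.\<close>
  have "(a \<cdot> b) \<cdot> y - assoc a b y = a \<cdot> (b \<cdot> y)"
    by (simp add: assoc_def)
  also have "\<dots> = (b \<cdot> y) \<cdot> a"
    unfolding b by (simp add: D)
  also have "\<dots> = (y \<cdot> b) \<cdot> a"
    using D[of b d] by (simp add: y_def)
  also have "\<dots> = y \<cdot> (b \<cdot> a) + assoc y b a"
    by (simp add: assoc_def)
  also have "assoc y b a = - assoc a b y"
    using assoc_swap23[of y a b] assoc_cyclic[where x = y and y = a and z = b] by simp
  finally have "(a \<cdot> b) \<cdot> y = y \<cdot> (b \<cdot> a)"
    by simp
  then have "(a \<cdot> b) \<cdot> e = e \<cdot> (b \<cdot> a)"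
    by (simp add: e mul_simps)
  then show ?thesis
    unfolding e_commute by (simp flip: comm_ab add: comm_def mul_simps)
qed

lemma c_mul_e_mul: "c \<cdot> (e \<cdot> x) = 0"
proof -
  have "assoc c e x = 0"
    by (simp add: assoc_c)
  then show ?thesis
    by (simp add: assoc_def c_mul_e)
qed

text \<open>With e = [c,d], both (cd)e = c(ed) and (dc)e = d(ce) vanish because c kills e and every
  ex.\<close>

lemma e_mul_e: "e \<cdot> e = 0"
proof -
  have "(c \<cdot> d) \<cdot> e = c \<cdot> (e \<cdot> d)"
    using assoc_c[of d e] by (simp add: assoc_def e_commute)
  moreover have "(d \<cdot> c) \<cdot> e = d \<cdot> (c \<cdot> e)"
    using assoc_c[of d e] assoc_swap12[of c d e] by (simp add: assoc_def)
  ultimately have "comm c d \<cdot> e = 0"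
    by (simp add: comm_def mul_simps c_mul_e_mul c_mul_e)
  then show ?thesis
    by (simp add: comm_cd)
qed

section \<open>Left-tapped words and their span\<close>

fun monomial :: "symb \<Rightarrow> 'a" where
  "monomial (ABCD i j k l) =
     (mul a ^^ i) ((mul b ^^ j) ((mul c ^^ k) ((mul d ^^ l) unit)))"
| "monomial (ABDE i j l) = (mul a ^^ i) ((mul b ^^ j) ((mul d ^^ l) e))"

text \<open>A left-stable subspace containing e on which left multiplications by generators commute;
  a word of left multiplications applied to e therefore reduces to some a^i(b^j(d^l e)) or to
  0.\<close>

definition "annihilated = {x. e \<cdot> x = 0 \<and> c \<cdot> x = 0 \<and> (\<forall>f\<in>gens. \<forall>g\<in>gens. assoc f g x = 0)}"

lemma annihilated_mul:
  assumes x: "x \<in> annihilated" and h: "h \<in> gens"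
  shows "h \<cdot> x \<in> annihilated"
proof -
  have "e \<cdot> (h \<cdot> x) = 0"
    using x h by (simp add: annihilated_def e_left_commute)
  moreover have "c \<cdot> (h \<cdot> x) = 0"
    using x mul_commute_left[of c h x] comm_gens_c[OF h] h comm_swap[of c h]
    by (auto simp: annihilated_def mul_minus_left)
  moreover have "assoc f g (h \<cdot> x) = 0" if "f \<in> gens" "g \<in> gens" for f g
    using x h that assoc_gens[OF that h]
    by (auto simp: annihilated_def assoc_mul_left assoc_comm_gens mul_simps)
  ultimately show ?thesis
    by (simp add: annihilated_def)
qed

lemma annihilated_commute:
  assumes "x \<in> annihilated" "f \<in> gens" "g \<in> gens"
  shows "g \<cdot> (f \<cdot> x) = f \<cdot> (g \<cdot> x)"
  using assms comm_gens[OF assms(2,3)] mul_commute_left[of g f x]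
  by (auto simp: annihilated_def mul_minus_left)

lemma annihilated_power: "x \<in> annihilated \<Longrightarrow> h \<in> gens \<Longrightarrow> (mul h ^^ n) x \<in> annihilated"
  by (induction n) (simp_all add: annihilated_mul)

lemma annihilated_power_commute:
  assumes "x \<in> annihilated" "f \<in> gens" "g \<in> gens"
  shows "g \<cdot> (mul f ^^ n) x = (mul f ^^ n) (g \<cdot> x)"
  using assms by (induction n) (simp_all add: annihilated_commute annihilated_power)

lemma e_annihilated: "e \<in> annihilated"
  using assoc_e assoc_cyclic by (simp add: annihilated_def e_mul_e c_mul_e)

text \<open>\<open>N\<close> collects the error terms of the reordering in \<open>V\<close>; it is
  kept separate because products by generators can be computed exactly on it.\<close>

definition "N = span (range (\<lambda>(i, j, l). monomial (ABDE i j l)))"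
definition "V = span (range monomial)"

lemma ABDE_in_N: "monomial (ABDE i j l) \<in> N"
  unfolding N_def by (rule span_base) (auto intro: image_eqI[of _ _ "(i, j, l)"])

lemma monomial_in_V: "monomial u \<in> V"
  unfolding V_def by (rule span_base) simp

lemma N_subset_V: "N \<subseteq> V"
  unfolding N_def V_def by (rule span_mono) (auto simp del: monomial.simps)

lemma subspace_N: "subspace N" and subspace_V: "subspace V"
  by (simp_all add: N_def V_def)

lemma N_induct:
  assumes "subspace S" "\<And>i j l. monomial (ABDE i j l) \<in> S" shows "N \<subseteq> S"
  unfolding N_def using assms by (intro span_minimal) auto

lemma V_induct:
  assumes "subspace S" "\<And>i j k l. monomial (ABCD i j k l) \<in> S" "\<And>i j l. monomial (ABDE i j l) \<in> S"
  shows "V \<subseteq> S"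
  unfolding V_def
proof (rule span_minimal)
  show "range monomial \<subseteq> S"
  proof safe
    fix u show "monomial u \<in> S"
      using assms(2,3) by (cases u) blast+
  qed
qed fact

lemma subspace_vimage_mul: "subspace S \<Longrightarrow> subspace {x. f \<cdot> x \<in> S}"
  "subspace S \<Longrightarrow> subspace {x. x \<cdot> f \<in> S}" "subspace S \<Longrightarrow> subspace {x. assoc f g x \<in> S}"
  by (auto simp: subspace_def mul_simps assoc_add assoc_scale)

lemma ABDE_annihilated: "monomial (ABDE i j l) \<in> annihilated"
  by (simp add: annihilated_power e_annihilated)

lemma ABDE_mul:
  "a \<cdot> monomial (ABDE i j l) = monomial (ABDE (Suc i) j l)"
  "b \<cdot> monomial (ABDE i j l) = monomial (ABDE i (Suc j) l)"
  "d \<cdot> monomial (ABDE i j l) = monomial (ABDE i j (Suc l))"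
  by (simp_all add: annihilated_power_commute annihilated_power e_annihilated)

lemma N_mul:
  assumes "f \<in> gens" "x \<in> N" shows "f \<cdot> x \<in> N"
proof -
  have "N \<subseteq> {x. f \<cdot> x \<in> N}"
  proof (rule N_induct)
    fix i j l
    have "c \<cdot> monomial (ABDE i j l) = 0" "e \<cdot> monomial (ABDE i j l) = 0"
      using ABDE_annihilated[of i j l] unfolding annihilated_def by blast+
    then show "monomial (ABDE i j l) \<in> {x. f \<cdot> x \<in> N}"
      using assms(1)
      by (elim gens_cases) (simp_all only: ABDE_mul mem_Collect_eq ABDE_in_N subspace_0[OF subspace_N])
  qed (simp add: subspace_vimage_mul subspace_N)
  then show ?thesis
    using assms by blast
qed

text \<open>For generators (f,g,h) = te, so the product rule reads (f,g,hx) = h(f,g,x) + t(ex).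
  Since \<open>N\<close> is stable under generators, \<open>S\<close> is too, and it contains
  \<open>unit\<close> and e, the innermost factors of all words.\<close>

lemma V_into_N:
  assumes "x \<in> V"
  shows "e \<cdot> x \<in> N" "\<And>f g. f \<in> gens \<Longrightarrow> g \<in> gens \<Longrightarrow> assoc f g x \<in> N"
proof -
  define S where "S = {x. e \<cdot> x \<in> N \<and> (\<forall>f\<in>gens. \<forall>g\<in>gens. assoc f g x \<in> N)}"
  have S: "subspace S"
    using subspace_N by (auto simp: S_def subspace_def mul_simps assoc_add assoc_scale)
  have mul: "h \<cdot> x \<in> S" if h: "h \<in> gens" and x: "x \<in> S" for h x
  proof -
    have "assoc f g (h \<cdot> x) \<in> N" if fg: "f \<in> gens" "g \<in> gens" for f g
    proof -
      obtain t where t: "assoc f g h = t *s e"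
        using assoc_gens fg h by blast
      have "assoc f g (h \<cdot> x) = h \<cdot> assoc f g x + t *s (e \<cdot> x)"
        using fg h by (simp add: assoc_mul_left t mul_simps assoc_comm_gens)
      then show ?thesis
        using x fg h by (auto simp: S_def intro!: subspace_add[OF subspace_N] subspace_scale[OF subspace_N] N_mul)
    qed
    then show ?thesis
      using x h by (simp add: S_def e_left_commute N_mul)
  qed
  have pow: "(mul h ^^ n) x \<in> S" if "h \<in> gens" "x \<in> S" for h x n
    using that by (induction n) (simp_all add: mul)
  have "e \<in> S" "unit \<in> S"
    using e_annihilated ABDE_in_N[of 0 0 0] subspace_0[OF subspace_N] by (auto simp: S_def annihilated_def)
  then have "V \<subseteq> S"
    by (intro V_induct S) (auto intro!: pow)
  then show "e \<cdot> x \<in> N" "\<And>f g. f \<in> gens \<Longrightarrow> g \<in> gens \<Longrightarrow> assoc f g x \<in> N"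
    using assms by (auto simp: S_def)
qed

lemma V_mulI:
  assumes "x \<in> V" "f \<in> gens" "\<And>i j k l. f \<cdot> monomial (ABCD i j k l) \<in> V"
  shows "f \<cdot> x \<in> V"
proof -
  have "V \<subseteq> {x. f \<cdot> x \<in> V}"
  proof (rule V_induct)
    show "subspace {x. f \<cdot> x \<in> V}"
      by (simp add: subspace_vimage_mul subspace_V)
    show "monomial (ABDE i j l) \<in> {x. f \<cdot> x \<in> V}" for i j l
      using N_mul[OF assms(2) ABDE_in_N] N_subset_V by blast
  qed (use assms in simp)
  then show ?thesis
    using assms by blast
qed

text \<open>The associators from \<open>mul_commute_left\<close> lie in \<open>N\<close>, so a swap
  within \<open>V\<close> only has to account for the other order and the commutator term.\<close>

lemma V_commute:
  assumes "f \<in> gens" "g \<in> gens" "x \<in> V" "f \<cdot> (g \<cdot> x) \<in> V" "comm f g \<cdot> x \<in> V"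
  shows "g \<cdot> (f \<cdot> x) \<in> V"
  unfolding mul_commute_left[of g f x]
  using assms V_into_N(2)[OF assms(3,1,2)] N_subset_V
  by (intro subspace_diff[OF subspace_V] subspace_add[OF subspace_V]) auto

text \<open>The generators are treated in the order a, c, e, b, d: moving b past a leaves [a,b] = c,
  and moving d past c leaves [c,d] = e.\<close>

lemma V_a: "x \<in> V \<Longrightarrow> a \<cdot> x \<in> V"
  by (rule V_mulI) (use monomial_in_V[of "ABCD (Suc _) _ _ _"] in auto)

lemma c_power_commute:
  assumes "f \<in> gens" "comm c f = 0" shows "c \<cdot> (mul f ^^ n) x = (mul f ^^ n) (c \<cdot> x)"
proof -
  have "c \<cdot> (f \<cdot> x) = f \<cdot> (c \<cdot> x)" for x
    using mul_commute_left[of c f x] assoc_c[OF assms(1), of x] assoc_swap12[of c f x] comm_swap[of c f] assms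
    by simp
  then show ?thesis
    by (induction n) simp_all
qed

lemma V_c: "x \<in> V \<Longrightarrow> c \<cdot> x \<in> V"
proof (rule V_mulI)
  show "c \<cdot> monomial (ABCD i j k l) \<in> V" for i j k l
    using monomial_in_V[of "ABCD i j (Suc k) l"] by (simp add: c_power_commute comm_table)
qed auto

lemma V_e: "x \<in> V \<Longrightarrow> e \<cdot> x \<in> V"
  using V_into_N(1) N_subset_V by blast

lemma V_b: "x \<in> V \<Longrightarrow> b \<cdot> x \<in> V"
proof (rule V_mulI)
  show "b \<cdot> monomial (ABCD i j k l) \<in> V" for i j k l
  proof (induction i)
    case 0
    then show ?case using monomial_in_V[of "ABCD 0 (Suc j) k l"] by simp
  next
    case (Suc i)
    have "b \<cdot> (a \<cdot> monomial (ABCD i j k l)) \<in> V"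
      by (rule V_commute) (use Suc in \<open>simp_all only: gens_simps monomial_in_V V_a V_c comm_table\<close>)
    then show ?case by simp
  qed
qed auto

lemma V_d: "x \<in> V \<Longrightarrow> d \<cdot> x \<in> V"
proof (rule V_mulI)
  have V0: "0 \<in> V"
    using subspace_V by (rule subspace_0)
  have 1: "d \<cdot> monomial (ABCD 0 0 k l) \<in> V" for k l
  proof (induction k)
    case 0
    then show ?case using monomial_in_V[of "ABCD 0 0 0 (Suc l)"] by simp
  next
    case (Suc k)
    have "d \<cdot> (c \<cdot> monomial (ABCD 0 0 k l)) \<in> V"
      by (rule V_commute) (use Suc in \<open>simp_all only: gens_simps monomial_in_V V_c V_e comm_table\<close>)
    then show ?case by simp
  qed
  have 2: "d \<cdot> monomial (ABCD 0 j k l) \<in> V" for j k l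
  proof (induction j)
    case 0
    then show ?case by (rule 1)
  next
    case (Suc j)
    have "d \<cdot> (b \<cdot> monomial (ABCD 0 j k l)) \<in> V"
      by (rule V_commute) (use Suc V0 in \<open>simp_all only: gens_simps monomial_in_V V_b comm_table mul_zero_left\<close>)
    then show ?case by simp
  qed
  show "d \<cdot> monomial (ABCD i j k l) \<in> V" for i j k l
  proof (induction i)
    case 0
    then show ?case by (rule 2)
  next
    case (Suc i)
    have "d \<cdot> (a \<cdot> monomial (ABCD i j k l)) \<in> V"
      by (rule V_commute) (use Suc V0 in \<open>simp_all only: gens_simps monomial_in_V V_a comm_table mul_zero_left\<close>)
    then show ?case by simp
  qed
qed auto

lemma V_mul_left: "f \<in> gens \<Longrightarrow> x \<in> V \<Longrightarrow> f \<cdot> x \<in> V"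
  by (elim gens_cases) (simp_all add: V_a V_b V_c V_d V_e)

text \<open>Right multiplication is reduced to left multiplication by (hx)f = h(xf) - (h,f,x), whose
  last term lies in \<open>N\<close>.\<close>

lemma V_mul_right:
  assumes "x \<in> V" "f \<in> gens" shows "x \<cdot> f \<in> V"
proof -
  define S where "S = {x \<in> V. x \<cdot> f \<in> V}"
  have S: "subspace S"
    using subspace_V by (auto simp: S_def subspace_def mul_simps)
  have mul: "h \<cdot> x \<in> S" if h: "h \<in> gens" and x: "x \<in> S" for h x
  proof -
    have "(h \<cdot> x) \<cdot> f = h \<cdot> (x \<cdot> f) - assoc h f x"
      using assoc_swap23[of h x f] by (simp add: assoc_def algebra_simps)
    moreover have "assoc h f x \<in> V"
      using V_into_N(2)[of x h f] x h assms N_subset_V by (auto simp: S_def)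
    ultimately show ?thesis
      using x h by (auto simp: S_def V_mul_left intro!: subspace_diff[OF subspace_V])
  qed
  have pow: "(mul h ^^ n) x \<in> S" if "h \<in> gens" "x \<in> S" for h x n
    using that by (induction n) (simp_all add: mul)
  have one: "unit \<in> V"
    using monomial_in_V[of "ABCD 0 0 0 0"] by simp
  then have "unit \<in> S"
    using V_mul_left[OF assms(2) one] by (auto simp: S_def)
  moreover from this have "e \<in> S"
    using mul[of e unit] by simp
  ultimately have "V \<subseteq> S"
    by (intro V_induct S) (auto intro!: pow)
  then show ?thesis
    using assms by (auto simp: S_def)
qed

theorem span_monomial: "span (range monomial) = UNIV"
proof -
  have "x \<in> V" for x
    by (rule operator_generated)
      (use monomial_in_V[of "ABCD 0 0 0 0"] subspace_V V_mul_left V_mul_right in simp_all)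
  then show ?thesis
    by (auto simp: V_def)
qed

end

section \<open>Quotients of algebra records\<close>

text \<open>Only what the coset constructions use, without associativity. Ideals are closed under
  scalars by definition; \<open>smult_minus_one\<close> makes them closed under negation.\<close>

locale algebra_record = abelian_group A for A :: "('f::field, 'v) module" (structure) +
  assumes m_closed: "\<lbrakk>x \<in> carrier A; y \<in> carrier A\<rbrakk> \<Longrightarrow> x \<otimes> y \<in> carrier A"
    and one_closed: "\<one> \<in> carrier A"
    and l_distr: "\<lbrakk>x \<in> carrier A; y \<in> carrier A; z \<in> carrier A\<rbrakk> \<Longrightarrow> (x \<oplus> y) \<otimes> z = x \<otimes> z \<oplus> y \<otimes> z"
    and r_distr: "\<lbrakk>x \<in> carrier A; y \<in> carrier A; z \<in> carrier A\<rbrakk> \<Longrightarrow> z \<otimes> (x \<oplus> y) = z \<otimes> x \<oplus> z \<otimes> y"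
    and smult_closed: "x \<in> carrier A \<Longrightarrow> t \<odot> x \<in> carrier A"
    and smult_r_distr: "\<lbrakk>x \<in> carrier A; y \<in> carrier A\<rbrakk> \<Longrightarrow> t \<odot> (x \<oplus> y) = t \<odot> x \<oplus> t \<odot> y"
    and smult_minus_one: "x \<in> carrier A \<Longrightarrow> (- 1) \<odot> x = \<ominus> x"
begin

lemma l_null: "x \<in> carrier A \<Longrightarrow> \<zero> \<otimes> x = \<zero>"
  using l_distr[of \<zero> \<zero> x] m_closed[of \<zero> x] by simp

lemma r_null: "x \<in> carrier A \<Longrightarrow> x \<otimes> \<zero> = \<zero>"
  using r_distr[of \<zero> \<zero> x] m_closed[of x \<zero>] by simp

lemma smult_zero: "t \<odot> \<zero> = \<zero>"
  using smult_r_distr[of \<zero> \<zero> t] smult_closed[of \<zero> t] by simp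

lemma alg_ideal_carrier: "alg_ideal (carrier A) A"
  by (simp add: alg_ideal_def m_closed smult_closed)

lemma alg_ideal_generated:
  assumes "S \<subseteq> carrier A" shows "alg_ideal (generated_ideal A S) A"
proof -
  \<comment> \<open>The family being intersected is nonempty, so the generated ideal stays inside
    the carrier.\<close>
  have "carrier A \<in> {I. alg_ideal I A \<and> S \<subseteq> I}"
    using assms alg_ideal_carrier by simp
  then have "generated_ideal A S \<subseteq> carrier A"
    unfolding generated_ideal_def by blast
  then show ?thesis
    unfolding alg_ideal_def generated_ideal_def by blast
qed

end

lemma generated_ideal_superset: "S \<subseteq> generated_ideal A S"
  by (auto simp: generated_ideal_def)

lemma generated_ideal_minimal: "alg_ideal I A \<Longrightarrow> S \<subseteq> I \<Longrightarrow> generated_ideal A S \<subseteq> I"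
  by (auto simp: generated_ideal_def)

definition alg_hom :: "('f, 'a) module \<Rightarrow> ('f, 'b) module \<Rightarrow> ('a \<Rightarrow> 'b) set"
  where "alg_hom A B = {h \<in> ring_hom A B. \<forall>t. \<forall>x\<in>carrier A. h (t \<odot>\<^bsub>A\<^esub> x) = t \<odot>\<^bsub>B\<^esub> h x}"

lemma alg_homI:
  assumes "\<And>x. x \<in> carrier A \<Longrightarrow> h x \<in> carrier B"
    and "\<And>x y. x \<in> carrier A \<Longrightarrow> y \<in> carrier A \<Longrightarrow> h (x \<otimes>\<^bsub>A\<^esub> y) = h x \<otimes>\<^bsub>B\<^esub> h y"
    and "\<And>x y. x \<in> carrier A \<Longrightarrow> y \<in> carrier A \<Longrightarrow> h (x \<oplus>\<^bsub>A\<^esub> y) = h x \<oplus>\<^bsub>B\<^esub> h y"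
    and "h \<one>\<^bsub>A\<^esub> = \<one>\<^bsub>B\<^esub>"
    and "\<And>t x. x \<in> carrier A \<Longrightarrow> h (t \<odot>\<^bsub>A\<^esub> x) = t \<odot>\<^bsub>B\<^esub> h x"
  shows "h \<in> alg_hom A B"
  using assms by (auto simp: alg_hom_def ring_hom_def)

lemma alg_hom_simps:
  assumes "h \<in> alg_hom A B" "x \<in> carrier A"
  shows "h x \<in> carrier B" "y \<in> carrier A \<Longrightarrow> h (x \<otimes>\<^bsub>A\<^esub> y) = h x \<otimes>\<^bsub>B\<^esub> h y"
    "y \<in> carrier A \<Longrightarrow> h (x \<oplus>\<^bsub>A\<^esub> y) = h x \<oplus>\<^bsub>B\<^esub> h y"
    "h (t \<odot>\<^bsub>A\<^esub> x) = t \<odot>\<^bsub>B\<^esub> h x" "h \<one>\<^bsub>A\<^esub> = \<one>\<^bsub>B\<^esub>"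
  using assms by (auto simp: alg_hom_def ring_hom_def)

locale algebra_record_hom = A: algebra_record A + B: algebra_record B
  for A :: "('f::field, 'v) module" and B :: "('f, 'w) module" +
  fixes h assumes h: "h \<in> alg_hom A B"
begin

lemmas h_simps = alg_hom_simps[OF h]

lemma h_zero: "h \<zero>\<^bsub>A\<^esub> = \<zero>\<^bsub>B\<^esub>"
  using h_simps(3)[of "\<zero>\<^bsub>A\<^esub>" "\<zero>\<^bsub>A\<^esub>"] h_simps(1)[of "\<zero>\<^bsub>A\<^esub>"] by simp

lemma h_minus: "x \<in> carrier A \<Longrightarrow> h (\<ominus>\<^bsub>A\<^esub> x) = \<ominus>\<^bsub>B\<^esub> h x"
  using h_simps(4)[of x "- 1"] h_simps(1)[of x] by (simp add: A.smult_minus_one B.smult_minus_one)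

lemma h_diff: "x \<in> carrier A \<Longrightarrow> y \<in> carrier A \<Longrightarrow> h (x \<ominus>\<^bsub>A\<^esub> y) = h x \<ominus>\<^bsub>B\<^esub> h y"
  by (simp add: a_minus_def h_simps h_minus)

lemma h_associator:
  assumes "x \<in> carrier A" "y \<in> carrier A" "z \<in> carrier A"
  shows "h (associator A x y z) = associator B (h x) (h y) (h z)"
  using assms by (simp add: associator_def h_diff A.m_closed h_simps)

lemma vimage_alg_ideal:
  assumes "alg_ideal I B" shows "alg_ideal {x \<in> carrier A. h x \<in> I} A"
  using assms unfolding alg_ideal_def
  by (auto simp: h_simps h_zero A.m_closed A.smult_closed)

lemma zero_alg_ideal: "alg_ideal {\<zero>\<^bsub>B\<^esub>} B"
  by (auto simp: alg_ideal_def B.smult_zero B.l_null B.r_null)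

lemma kernel_alg_ideal: "alg_ideal {x \<in> carrier A. h x = \<zero>\<^bsub>B\<^esub>} A"
  using vimage_alg_ideal[OF zero_alg_ideal] by simp

end

locale algebra_record_ideal = algebra_record A for A :: "('f::field, 'v) module" (structure) +
  fixes I assumes I: "alg_ideal I A"
begin

abbreviation "Q \<equiv> quotient_algebra A I"
abbreviation "cls x \<equiv> I +> x"

lemma I_simps: "x \<in> I \<Longrightarrow> x \<in> carrier A" "\<zero> \<in> I" "x \<in> I \<Longrightarrow> y \<in> I \<Longrightarrow> x \<oplus> y \<in> I"
  "x \<in> I \<Longrightarrow> t \<odot> x \<in> I" "x \<in> I \<Longrightarrow> z \<in> carrier A \<Longrightarrow> x \<otimes> z \<in> I"
  "x \<in> I \<Longrightarrow> z \<in> carrier A \<Longrightarrow> z \<otimes> x \<in> I"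
  using I by (auto simp: alg_ideal_def)

lemma I_minus: "x \<in> I \<Longrightarrow> \<ominus> x \<in> I"
  using I_simps(4)[of x "- 1"] by (simp add: smult_minus_one I_simps(1))

sublocale abelian_subgroup I A
proof (rule abelian_subgroupI3)
  show "additive_subgroup I A"
    by (rule additive_subgroup.intro, rule subgroup.intro)
      (use I_simps I_minus in \<open>auto simp: a_inv_def\<close>)
qed (rule abelian_group_axioms)

lemma mem_cls: "z \<in> cls x \<longleftrightarrow> (\<exists>i\<in>I. z = i \<oplus> x)"
  by (auto simp: a_r_coset_def')

lemma cls_self: "x \<in> carrier A \<Longrightarrow> x \<in> cls x"
  using I_simps(2) by (auto simp: mem_cls intro!: bexI[of _ \<zero>])

lemma cls_eqI:
  assumes "x \<in> carrier A" "i \<in> I" shows "cls (i \<oplus> x) = cls x"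
  by (rule sym, rule a_repr_independence) (use assms a_subgroup in \<open>auto simp: mem_cls\<close>)

lemma cls_eq_iff:
  assumes "x \<in> carrier A" "y \<in> carrier A" shows "cls x = cls y \<longleftrightarrow> x \<ominus> y \<in> I"
proof
  assume "cls x = cls y"
  then obtain i where "i \<in> I" "x = i \<oplus> y"
    using cls_self[OF assms(1)] by (auto simp: mem_cls)
  then show "x \<ominus> y \<in> I"
    using assms I_simps(1) by (simp add: minus_eq a_assoc r_neg)
next
  assume "x \<ominus> y \<in> I"
  then have "cls ((x \<ominus> y) \<oplus> y) = cls y"
    using assms by (simp add: cls_eqI)
  then show "cls x = cls y"
    using assms by (simp add: minus_eq a_assoc l_neg)
qed

lemma carrier_Q: "carrier Q = {cls x | x. x \<in> carrier A}"
  by (auto simp: quotient_algebra_def A_RCOSETS_def')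

lemma add_Q: "x \<in> carrier A \<Longrightarrow> y \<in> carrier A \<Longrightarrow> cls x \<oplus>\<^bsub>Q\<^esub> cls y = cls (x \<oplus> y)"
  by (simp add: quotient_algebra_def a_rcos_sum)

lemma one_Q: "\<one>\<^bsub>Q\<^esub> = cls \<one>"
  by (simp add: quotient_algebra_def)

lemma zero_Q: "\<zero>\<^bsub>Q\<^esub> = cls \<zero>"
  by (auto simp: quotient_algebra_def mem_cls I_simps)

lemma mult_Q:
  assumes "x \<in> carrier A" "y \<in> carrier A" shows "cls x \<otimes>\<^bsub>Q\<^esub> cls y = cls (x \<otimes> y)"
proof -
  have "cls (x' \<otimes> y') = cls (x \<otimes> y)" if xy: "x' \<in> cls x" "y' \<in> cls y" for x' y'
  proof -
    obtain i j where ij: "i \<in> I" "j \<in> I" "x' = i \<oplus> x" "y' = j \<oplus> y"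
      using xy by (auto simp: mem_cls)
    then have "x' \<otimes> y' = (i \<otimes> (j \<oplus> y) \<oplus> x \<otimes> j) \<oplus> x \<otimes> y"
      using assms by (simp add: l_distr r_distr I_simps m_closed a_ac)
    moreover have "i \<otimes> (j \<oplus> y) \<oplus> x \<otimes> j \<in> I"
      using ij assms by (simp add: I_simps)
    ultimately show ?thesis
      using assms by (simp add: cls_eqI m_closed)
  qed
  \<comment> \<open>Products of cosets are unions over all pairs of representatives; all members are
    the same coset and the union is nonempty.\<close>
  then have "(\<Union>x'\<in>cls x. \<Union>y'\<in>cls y. cls (x' \<otimes> y')) = cls (x \<otimes> y)"
    using cls_self[OF assms(1)] cls_self[OF assms(2)] by blast
  then show ?thesis
    by (simp add: quotient_algebra_def rcoset_mult_def)
qed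

lemma smult_Q:
  assumes "x \<in> carrier A" shows "t \<odot>\<^bsub>Q\<^esub> cls x = cls (t \<odot> x)"
proof -
  have "cls (t \<odot> x') = cls (t \<odot> x)" if "x' \<in> cls x" for x'
    using that assms by (auto simp: mem_cls smult_r_distr I_simps cls_eqI smult_closed)
  then have "(\<Union>x'\<in>cls x. cls (t \<odot> x')) = cls (t \<odot> x)"
    using cls_self[OF assms] by blast
  then show ?thesis
    by (simp add: quotient_algebra_def)
qed

lemmas Q_simps = add_Q one_Q zero_Q mult_Q smult_Q

lemma cls_closed: "x \<in> carrier A \<Longrightarrow> cls x \<in> carrier Q"
  by (auto simp: carrier_Q)

lemma abelian_group_Q: "abelian_group Q"
proof (rule abelian_groupI)
  fix X assume "X \<in> carrier Q"
  then obtain x where "x \<in> carrier A" "X = cls x"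
    by (auto simp: carrier_Q)
  then show "\<exists>Y\<in>carrier Q. Y \<oplus>\<^bsub>Q\<^esub> X = \<zero>\<^bsub>Q\<^esub>"
    by (intro bexI[of _ "cls (\<ominus> x)"]) (simp_all add: Q_simps l_neg cls_closed)
qed (auto simp: carrier_Q Q_simps a_ac; blast?)+

lemma algebra_record_Q: "algebra_record Q"
proof -
  interpret Q: abelian_group Q by (rule abelian_group_Q)
  have "(- 1) \<odot>\<^bsub>Q\<^esub> X = \<ominus>\<^bsub>Q\<^esub> X" if X: "X \<in> carrier Q" for X
  proof -
    obtain x where x: "x \<in> carrier A" "X = cls x"
      using X by (auto simp: carrier_Q)
    then have "((- 1) \<odot>\<^bsub>Q\<^esub> X) \<oplus>\<^bsub>Q\<^esub> X = \<zero>\<^bsub>Q\<^esub>"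
      by (simp add: Q_simps smult_minus_one l_neg)
    then show ?thesis
      using x by (intro Q.minus_equality[symmetric]) (simp_all add: Q_simps cls_closed smult_closed)
  qed
  then show ?thesis
    by unfold_locales
      (auto simp: carrier_Q Q_simps m_closed one_closed smult_closed l_distr r_distr smult_r_distr; blast intro: m_closed smult_closed one_closed)+
qed

lemma cls_hom: "(\<lambda>x. cls x) \<in> alg_hom A Q"
  by (rule alg_homI) (simp_all add: cls_closed Q_simps)

lemma lift:
  assumes B: "algebra_record B" and h: "h \<in> alg_hom A B" and ker: "\<And>x. x \<in> I \<Longrightarrow> h x = \<zero>\<^bsub>B\<^esub>"
  obtains g where "g \<in> alg_hom Q B" "\<And>x. x \<in> carrier A \<Longrightarrow> g (cls x) = h x"
proof -
  interpret B: algebra_record B by (rule B)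
  interpret algebra_record_hom A B h
    by unfold_locales (rule h)
  define g where "g X = h (SOME x. x \<in> carrier A \<and> X = cls x)" for X
  have g: "g (cls x) = h x" if x: "x \<in> carrier A" for x
  proof -
    define x' where "x' = (SOME x'. x' \<in> carrier A \<and> cls x = cls x')"
    have x': "x' \<in> carrier A \<and> cls x = cls x'"
      unfolding x'_def by (rule someI[of _ x]) (use x in simp)
    then have "x \<ominus> x' \<in> I"
      using x cls_eq_iff by blast
    then have "h x \<ominus>\<^bsub>B\<^esub> h x' = \<zero>\<^bsub>B\<^esub>"
      using ker[of "x \<ominus> x'"] h_diff[of x x'] x x' by metis
    moreover have "h x = (h x \<ominus>\<^bsub>B\<^esub> h x') \<oplus>\<^bsub>B\<^esub> h x'"
      using x x' h_simps(1) by (simp add: B.minus_eq B.a_assoc B.l_neg)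
    ultimately have "h x = h x'"
      using x' h_simps(1) by simp
    then show ?thesis
      by (simp add: g_def x'_def)
  qed
  show ?thesis
  proof
    show "g \<in> alg_hom Q B"
      by (rule alg_homI) (auto simp: carrier_Q Q_simps g h_simps m_closed smult_closed one_closed h_simps(5)[OF one_closed])
  qed (rule g)
qed

text \<open>The first isomorphism theorem, stated for an ideal given in advance, so that the
  quotient keeps the form in which the enveloping algebra is defined.\<close>

lemma lift_iso:
  assumes B: "algebra_record B" and h: "h \<in> alg_hom A B" and surj: "h ` carrier A = carrier B"
    and ker: "\<And>x. x \<in> carrier A \<Longrightarrow> h x = \<zero>\<^bsub>B\<^esub> \<longleftrightarrow> x \<in> I"
  shows "\<exists>g. g \<in> alg_iso Q B"
proof -
  obtain g where g: "g \<in> alg_hom Q B" "\<And>x. x \<in> carrier A \<Longrightarrow> g (cls x) = h x"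
    using lift[OF B h] ker I_simps(1) by metis
  interpret B: algebra_record B by (rule B)
  interpret algebra_record_hom A B h
    by unfold_locales (rule h)
  have "inj_on g (carrier Q)"
  proof (rule inj_onI)
    fix X Y assume XY: "X \<in> carrier Q" "Y \<in> carrier Q" "g X = g Y"
    then obtain x y where xy: "x \<in> carrier A" "y \<in> carrier A" "X = cls x" "Y = cls y"
      by (auto simp: carrier_Q)
    with XY have "h x = h y" by (simp add: g)
    then have "h (x \<ominus> y) = \<zero>\<^bsub>B\<^esub>"
      using xy h_simps(1) by (simp add: h_diff B.minus_eq B.r_neg)
    then show "X = Y"
      using xy ker[of "x \<ominus> y"] by (simp add: cls_eq_iff)
  qed
  moreover have "g ` carrier Q = carrier B"
    unfolding surj[symmetric] carrier_Q by (force simp: g image_iff)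
  ultimately show ?thesis
    using g(1) by (auto simp: alg_iso_def ring_iso_def alg_hom_def bij_betw_def)
qed

end


section \<open>Comparison of the enveloping algebra with the symbol algebra\<close>

lemma uminus_record:
  assumes "abelian_group A" "carrier A = UNIV" "add A = (+)" "zero A = 0"
  shows "a_inv A x = - x" "x \<ominus>\<^bsub>A\<^esub> y = x - (y :: 'v::ab_group_add)"
proof -
  interpret abelian_group A by (rule assms)
  show *: "\<ominus>\<^bsub>A\<^esub> x = - x" for x
    by (rule minus_equality) (simp_all add: assms)
  show "x \<ominus>\<^bsub>A\<^esub> y = x - y"
    by (simp add: minus_eq * assms)
qed

lemma basis_algebra_simps [simp]:
  "carrier (basis_algebra m u) = UNIV" "x \<otimes>\<^bsub>basis_algebra m u\<^esub> y = bilinear_ext m x y"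
  "\<one>\<^bsub>basis_algebra m u\<^esub> = Poly_Mapping.single u 1" "\<zero>\<^bsub>basis_algebra m u\<^esub> = 0"
  "x \<oplus>\<^bsub>basis_algebra m u\<^esub> y = x + y" "t \<odot>\<^bsub>basis_algebra m u\<^esub> x = scale t x"
  by (simp_all add: basis_algebra_def)

lemma abelian_group_basis_algebra: "abelian_group (basis_algebra m u)"
  by (rule abelian_groupI) (auto simp: ac_simps intro: exI[of _ "- _"])

lemma basis_algebra_minus [simp]:
  "\<ominus>\<^bsub>basis_algebra m u\<^esub> x = - x" "x \<ominus>\<^bsub>basis_algebra m u\<^esub> y = x - y"
  by (rule uminus_record[OF abelian_group_basis_algebra]; simp add: basis_algebra_def)+

lemma algebra_record_basis_algebra: "algebra_record (basis_algebra m u)"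
proof -
  interpret abelian_group "basis_algebra m u" by (rule abelian_group_basis_algebra)
  show ?thesis
    by unfold_locales (simp_all add: bilinear_ext_add_left bilinear_ext_add_right scale.scale_right_distrib)
qed

interpretation F: algebra_record "free_algebra :: ('f::field, 'g word option \<Rightarrow>\<^sub>0 'f) module"
  unfolding free_algebra_def by (rule algebra_record_basis_algebra)

interpretation S: algebra_record "symb_algebra :: ('f::field, symb \<Rightarrow>\<^sub>0 'f) module"
  unfolding symb_algebra_def by (rule algebra_record_basis_algebra)

abbreviation free_mult :: "('g word option \<Rightarrow>\<^sub>0 'f::field) \<Rightarrow> ('g word option \<Rightarrow>\<^sub>0 'f) \<Rightarrow> 'g word option \<Rightarrow>\<^sub>0 'f"
  where "free_mult \<equiv> bilinear_ext (\<lambda>u v. Poly_Mapping.single (monomial_mult u v) 1)"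

abbreviation symb_mult :: "(symb \<Rightarrow>\<^sub>0 'f::field) \<Rightarrow> (symb \<Rightarrow>\<^sub>0 'f) \<Rightarrow> symb \<Rightarrow>\<^sub>0 'f"
  where "symb_mult \<equiv> bilinear_ext symb_table"

abbreviation sy :: "symb \<Rightarrow> symb \<Rightarrow>\<^sub>0 'f::field"
  where "sy u \<equiv> Poly_Mapping.single u 1"

lemma symb_mult_unit_left: "symb_mult (sy (ABCD 0 0 0 0)) x = x"
proof (induction x rule: poly_mapping_additive_induct)
  case (single u t)
  show ?case by (cases u) (simp_all add: bilinear_ext_single)
qed (simp add: bilinear_ext_add_right)

lemma symb_mult_unit_right: "symb_mult x (sy (ABCD 0 0 0 0)) = x"
proof (induction x rule: poly_mapping_additive_induct)
  case (single u t)
  have "(\<Sum>\<mu> = 0..j. Poly_Mapping.single (ABCD (i - \<mu>) (j - \<mu>) (k + \<mu>) l)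
      ((- 1) ^ \<mu> * (of_nat (fact \<mu>) * of_nat (j choose \<mu>) * of_nat (0 choose \<mu>)))) =
      (\<Sum>\<mu> = 0..j. if \<mu> = 0 then Poly_Mapping.single (ABCD i j k l) (1 :: 'a) else 0)" for i j k l
    by (rule sum.cong) (auto simp: binomial_eq_0)
  then show ?case by (cases u) (simp_all add: bilinear_ext_single)
qed (simp add: bilinear_ext_add_left)

section \<open>Evaluation of the free algebra in the symbol algebra\<close>

fun gen_symb :: "gen \<Rightarrow> symb" where
  "gen_symb gen.a = ABCD 1 0 0 0" | "gen_symb gen.b = ABCD 0 1 0 0" | "gen_symb gen.c = ABCD 0 0 1 0"
| "gen_symb gen.d = ABCD 0 0 0 1" | "gen_symb gen.e = ABDE 0 0 0"

fun word_value :: "gen word \<Rightarrow> symb \<Rightarrow>\<^sub>0 'f::field" where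
  "word_value (Gen g) = sy (gen_symb g)"
| "word_value (Prod u v) = symb_mult (word_value u) (word_value v)"

fun opt_value :: "gen word option \<Rightarrow> symb \<Rightarrow>\<^sub>0 'f::field" where
  "opt_value None = sy (ABCD 0 0 0 0)"
| "opt_value (Some w) = word_value w"

definition ev :: "(gen word option \<Rightarrow>\<^sub>0 'f::field) \<Rightarrow> symb \<Rightarrow>\<^sub>0 'f"
  where "ev = lin_ext scale opt_value"

lemma opt_value_mult: "opt_value (monomial_mult u v) = symb_mult (opt_value u) (opt_value v)"
  by (cases u; cases v) (simp_all add: symb_mult_unit_left symb_mult_unit_right)

lemma ev_add: "ev (x + y) = ev x + ev y" and ev_scale: "ev (scale t x) = scale t (ev x)"
  and ev_diff: "ev (x - y) = ev x - ev y" and ev_uminus: "ev (- x) = - ev x" and ev_0 [simp]: "ev 0 = 0"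
  and ev_single [simp]: "ev (Poly_Mapping.single u t) = scale t (opt_value u)"
  by (simp_all add: ev_def scale.lin_ext_add scale.lin_ext_scale scale.lin_ext_diff scale.lin_ext_uminus)

lemma ev_mult: "ev (free_mult x y) = symb_mult (ev x) (ev y)"
proof (induction x rule: poly_mapping_additive_induct)
  case (single u s)
  show ?case
    by (induction y rule: poly_mapping_additive_induct)
      (simp_all add: bilinear_ext_single bilinear_ext_add_right bilinear_ext_scale_left
        bilinear_ext_scale_right ev_add opt_value_mult mult.commute)
qed (simp_all add: bilinear_ext_add_left ev_add)

lemma ev_hom: "ev \<in> alg_hom free_algebra symb_algebra"
  by (rule alg_homI) (simp_all add: free_algebra_def symb_algebra_def ev_mult ev_add ev_scale)

interpretation ev: algebra_record_hom free_algebra symb_algebra ev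
  by unfold_locales (rule ev_hom)

lemma gen_embed_eq: "gen_embed = lin_ext scale (\<lambda>g. Poly_Mapping.single (Some (Gen g)) 1)"
  by (rule ext) (simp add: gen_embed_def lin_ext_def)

lemma gen_embed_add: "gen_embed (x + y) = gen_embed x + gen_embed y"
  and gen_embed_uminus: "gen_embed (- x) = - gen_embed x"
  and gen_embed_0 [simp]: "gen_embed 0 = 0"
  and gen_embed_single [simp]: "gen_embed (Poly_Mapping.single g t) = Poly_Mapping.single (Some (Gen g)) t"
  by (simp_all add: gen_embed_eq scale.lin_ext_add scale.lin_ext_uminus)

lemma ev_bracket:
  "symb_mult (ev (gen_embed f)) (ev (gen_embed g)) - symb_mult (ev (gen_embed g)) (ev (gen_embed f))
    = ev (gen_embed (malcev_bracket f g))"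
proof (induction f rule: poly_mapping_additive_induct)
  case (single u s)
  show ?case
  proof (induction g rule: poly_mapping_additive_induct)
    case (single v t)
    show ?case
      by (cases u; cases v)
        (simp_all add: malcev_bracket_def bilinear_ext_single bilinear_ext_scale_left bilinear_ext_scale_right
          scale.scale_right_diff_distrib mult.commute single_uminus ev_uminus gen_embed_uminus)
  qed (simp add: malcev_bracket_def bilinear_ext_add_left bilinear_ext_add_right gen_embed_add ev_add algebra_simps)
qed (simp add: malcev_bracket_def bilinear_ext_add_left bilinear_ext_add_right gen_embed_add ev_add algebra_simps)


lemma symb_alternative:
  assumes "(6 :: 'f::field) \<noteq> 0"
  shows "alternative_algebra scale symb_mult (sy (ABCD 0 0 0 0) :: symb \<Rightarrow>\<^sub>0 'f)"
proof -
  interpret nonassociative_algebra scale symb_mult "sy (ABCD 0 0 0 0) :: symb \<Rightarrow>\<^sub>0 'f"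
    by unfold_locales (simp_all add: bilinear_ext_add_left bilinear_ext_add_right bilinear_ext_scale_left
      bilinear_ext_scale_right symb_mult_unit_left symb_mult_unit_right)
  show ?thesis
    by unfold_locales (simp_all add: assoc_def symb_left_alternative[OF assms] symb_right_alternative[OF assms])
qed

lemma symb_associator:
  assumes "(6 :: 'f::field) \<noteq> 0"
  shows "associator symb_algebra x x (y :: symb \<Rightarrow>\<^sub>0 'f) = 0" "associator symb_algebra y x x = 0"
    "associator symb_algebra x y z + associator symb_algebra y x z = 0"
    "associator symb_algebra x y z + associator symb_algebra x z y = 0"
proof -
  interpret alternative_algebra scale symb_mult "sy (ABCD 0 0 0 0) :: symb \<Rightarrow>\<^sub>0 'f"
    by (rule symb_alternative[OF assms])
  have *: "associator symb_algebra x y z = assoc x y z" for x y z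
    by (simp add: associator_def assoc_def symb_algebra_def)
  show "associator symb_algebra x x y = 0" "associator symb_algebra y x x = 0"
    by (simp_all add: * left_alternative right_alternative)
  show "associator symb_algebra x y z + associator symb_algebra y x z = 0"
    "associator symb_algebra x y z + associator symb_algebra x z y = 0"
    using assoc_swap12[of x y z] assoc_swap23[of x y z] by (simp_all add: *)
qed

definition alternators :: "('f::field, 'v) module \<Rightarrow> 'v set"
  where "alternators A = {associator A x x y | x y. x \<in> carrier A \<and> y \<in> carrier A} \<union>
     {associator A y x x | x y. x \<in> carrier A \<and> y \<in> carrier A}"

lemma alternator_ideal_eq: "alternator_ideal A = generated_ideal A (alternators A)"
  by (simp add: alternator_ideal_def alternators_def)

lemma (in algebra_record_hom) h_alternators:
  assumes "x \<in> alternators A" shows "h x \<in> alternators B"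
proof -
  obtain u v where uv: "u \<in> carrier A" "v \<in> carrier A" and "x = associator A u u v \<or> x = associator A v u u"
    using assms unfolding alternators_def by blast
  then have "h x = associator B (h u) (h u) (h v) \<or> h x = associator B (h v) (h u) (h u)"
    by (auto simp: h_associator)
  then show ?thesis
    using h_simps(1)[OF uv(1)] h_simps(1)[OF uv(2)] unfolding alternators_def by blast
qed

lemma (in algebra_record) associator_closed:
  "\<lbrakk>x \<in> carrier A; y \<in> carrier A; z \<in> carrier A\<rbrakk> \<Longrightarrow> associator A x y z \<in> carrier A"
  by (simp add: associator_def m_closed)

lemma (in algebra_record) alternators_closed: "alternators A \<subseteq> carrier A"
  by (auto simp: alternators_def associator_closed)

abbreviation relators :: "(gen word option \<Rightarrow>\<^sub>0 'f::field) set"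
  where "relators \<equiv> env_relators malcev_bracket"

text \<open>Both sets of relations are imposed at once in the free algebra, which replaces the two
  successive quotients by one.\<close>

definition alt_ideal :: "(gen word option \<Rightarrow>\<^sub>0 'f::field) set"
  where "alt_ideal = generated_ideal free_algebra (relators \<union> alternators free_algebra)"

lemma free_algebra_simps [simp]:
  "carrier free_algebra = UNIV" "x \<otimes>\<^bsub>free_algebra\<^esub> y = free_mult x y"
  "\<one>\<^bsub>free_algebra\<^esub> = Poly_Mapping.single None 1" "\<zero>\<^bsub>free_algebra\<^esub> = 0"
  "x \<oplus>\<^bsub>free_algebra\<^esub> y = x + y" "t \<odot>\<^bsub>free_algebra\<^esub> x = scale t x"
  "x \<ominus>\<^bsub>free_algebra\<^esub> y = x - y"
  by (simp_all add: free_algebra_def)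

lemma symb_algebra_simps [simp]:
  "carrier symb_algebra = UNIV" "x \<otimes>\<^bsub>symb_algebra\<^esub> y = symb_mult x y"
  "\<one>\<^bsub>symb_algebra\<^esub> = sy (ABCD 0 0 0 0)" "\<zero>\<^bsub>symb_algebra\<^esub> = 0"
  "x \<oplus>\<^bsub>symb_algebra\<^esub> y = x + y" "t \<odot>\<^bsub>symb_algebra\<^esub> x = scale t x"
  "x \<ominus>\<^bsub>symb_algebra\<^esub> y = x - y"
  by (simp_all add: symb_algebra_def)

lemma ev_relators:
  assumes "(6 :: 'f::field) \<noteq> 0" "x \<in> relators \<union> alternators free_algebra"
  shows "ev (x :: gen word option \<Rightarrow>\<^sub>0 'f) = 0"
  using assms(2)
  by (auto simp: env_relators_def Let_def alternators_def ev_add ev_diff ev_mult ev_bracket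
      ev.h_associator symb_associator[OF assms(1)])

lemma alt_ideal_subset_kernel:
  assumes "(6 :: 'f::field) \<noteq> 0" "x \<in> alt_ideal"
  shows "ev (x :: gen word option \<Rightarrow>\<^sub>0 'f) = 0"
proof -
  have "alt_ideal \<subseteq> {x \<in> carrier free_algebra. ev x = (\<zero>\<^bsub>symb_algebra\<^esub> :: symb \<Rightarrow>\<^sub>0 'f)}"
    unfolding alt_ideal_def
    by (rule generated_ideal_minimal[OF ev.kernel_alg_ideal]) (use ev_relators[OF assms(1)] in auto)
  then show ?thesis
    using assms(2) by auto
qed

lemma alg_ideal_alt_ideal: "alg_ideal alt_ideal free_algebra"
  unfolding alt_ideal_def by (rule F.alg_ideal_generated) simp

lemma alt_ideal_simps:
  "0 \<in> alt_ideal" "x \<in> alt_ideal \<Longrightarrow> y \<in> alt_ideal \<Longrightarrow> x + y \<in> alt_ideal"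
  "x \<in> alt_ideal \<Longrightarrow> scale t x \<in> alt_ideal" "x \<in> alt_ideal \<Longrightarrow> free_mult x z \<in> alt_ideal"
  "x \<in> alt_ideal \<Longrightarrow> free_mult z x \<in> alt_ideal"
  using alg_ideal_alt_ideal by (auto simp: alg_ideal_def)

lemma alt_ideal_uminus: "x \<in> alt_ideal \<Longrightarrow> - x \<in> alt_ideal"
  using alt_ideal_simps(3)[of x "- 1"] by simp

lemma alt_ideal_diff: "x \<in> alt_ideal \<Longrightarrow> y \<in> alt_ideal \<Longrightarrow> x - y \<in> alt_ideal"
  using alt_ideal_simps(2)[of x "- y"] by (simp add: alt_ideal_uminus)

text \<open>The quotient as a type, to which the type-based locales apply.\<close>

quotient_type (overloaded) 'f alt_alg = "gen word option \<Rightarrow>\<^sub>0 'f::field" / "\<lambda>x y. x - y \<in> alt_ideal"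
proof (rule equivpI)
  show "reflp (\<lambda>x y. x - y \<in> alt_ideal)"
    by (simp add: reflp_def alt_ideal_simps)
  show "symp (\<lambda>x y. x - y \<in> alt_ideal)"
    unfolding symp_def using alt_ideal_uminus by fastforce
  show "transp (\<lambda>x y. x - y \<in> alt_ideal)"
    unfolding transp_def using alt_ideal_simps(2) by fastforce
qed

instantiation alt_alg :: (field) ab_group_add
begin

lift_definition zero_alt_alg :: "'a alt_alg" is 0 .
lift_definition plus_alt_alg :: "'a alt_alg \<Rightarrow> 'a alt_alg \<Rightarrow> 'a alt_alg" is "(+)"
  by (simp add: add_diff_add alt_ideal_simps)
lift_definition minus_alt_alg :: "'a alt_alg \<Rightarrow> 'a alt_alg \<Rightarrow> 'a alt_alg" is "(-)"
proof -
  fix x x' y y' :: "gen word option \<Rightarrow>\<^sub>0 'a"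
  assume "x - x' \<in> alt_ideal" "y - y' \<in> alt_ideal"
  then have "(x - x') - (y - y') \<in> alt_ideal"
    by (rule alt_ideal_diff)
  then show "(x - y) - (x' - y') \<in> alt_ideal"
    by (simp add: algebra_simps)
qed
lift_definition uminus_alt_alg :: "'a alt_alg \<Rightarrow> 'a alt_alg" is uminus
  by (simp only: minus_diff_minus alt_ideal_uminus)

instance
  by standard (transfer; simp add: alt_ideal_simps ac_simps)+

end

lift_definition alt_scale :: "'f::field \<Rightarrow> 'f alt_alg \<Rightarrow> 'f alt_alg" is scale
  by (simp add: alt_ideal_simps flip: scale.scale_right_diff_distrib)

lift_definition alt_mult :: "'f::field alt_alg \<Rightarrow> 'f alt_alg \<Rightarrow> 'f alt_alg" is free_mult
proof -
  fix x x' y y' :: "gen word option \<Rightarrow>\<^sub>0 'f"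
  assume "x - x' \<in> alt_ideal" "y - y' \<in> alt_ideal"
  then have "free_mult (x - x') y + free_mult x' (y - y') \<in> alt_ideal"
    by (simp add: alt_ideal_simps)
  moreover have "free_mult (x - x') y + free_mult x' (y - y') = free_mult x y - free_mult x' y'"
    using bilinear_ext_add_left[of _ "x - x'" x' y] bilinear_ext_add_right[of _ x' "y - y'" y']
    by (simp add: algebra_simps)
  ultimately show "free_mult x y - free_mult x' y' \<in> alt_ideal"
    by simp
qed

lift_definition alt_one :: "'f::field alt_alg" is "Poly_Mapping.single None 1" .

lift_definition alt_gen :: "gen \<Rightarrow> 'f::field alt_alg" is "\<lambda>g. Poly_Mapping.single (Some (Gen g)) 1" .

lemma free_mult_unit: "free_mult (Poly_Mapping.single None 1) x = x" "free_mult x (Poly_Mapping.single None 1) = x"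
proof -
  have [simp]: "monomial_mult u None = u" for u :: "'g word option"
    by (cases u) simp_all
  show "free_mult (Poly_Mapping.single None 1) x = x" "free_mult x (Poly_Mapping.single None 1) = x"
    by (induction x rule: poly_mapping_additive_induct)
      (simp_all add: bilinear_ext_single bilinear_ext_add_left bilinear_ext_add_right)
qed

lemma alt_scale_simps:
  fixes x y :: "'f::field alt_alg"
  shows "alt_scale t (x + y) = alt_scale t x + alt_scale t y"
    "alt_scale (t + u) x = alt_scale t x + alt_scale u x"
    "alt_scale t (alt_scale u x) = alt_scale (t * u) x" "alt_scale 1 x = x"
  by (transfer, simp add: alt_ideal_simps scale.scale_right_distrib scale.scale_left_distrib)+

lemma alt_mult_simps:
  fixes x y z :: "'f::field alt_alg"
  shows "alt_mult (x + y) z = alt_mult x z + alt_mult y z"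
    "alt_mult z (x + y) = alt_mult z x + alt_mult z y"
    "alt_mult (alt_scale t x) y = alt_scale t (alt_mult x y)"
    "alt_mult x (alt_scale t y) = alt_scale t (alt_mult x y)"
    "alt_mult alt_one x = x" "alt_mult x alt_one = x"
  by (transfer, simp add: alt_ideal_simps bilinear_ext_add_left bilinear_ext_add_right bilinear_ext_scale_left
      bilinear_ext_scale_right free_mult_unit)+

lemma alt_mult_alternative:
  fixes x y :: "'f::field alt_alg"
  shows "alt_mult (alt_mult x x) y = alt_mult x (alt_mult x y)"
    "alt_mult (alt_mult y x) x = alt_mult y (alt_mult x x)"
proof -
  have "associator free_algebra x x y \<in> alt_ideal" "associator free_algebra y x x \<in> alt_ideal"
    for x y :: "gen word option \<Rightarrow>\<^sub>0 'f"
    unfolding alt_ideal_def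
    by (rule subsetD[OF generated_ideal_superset]; force simp: alternators_def)+
  then show "alt_mult (alt_mult x x) y = alt_mult x (alt_mult x y)"
    "alt_mult (alt_mult y x) x = alt_mult y (alt_mult x x)"
    by (transfer, simp add: associator_def)+
qed

lemma alternative_algebra_alt: "alternative_algebra alt_scale alt_mult alt_one"
proof -
  interpret nonassociative_algebra alt_scale alt_mult alt_one
    by unfold_locales (simp_all add: alt_scale_simps alt_mult_simps)
  show ?thesis
    by unfold_locales (simp_all add: assoc_def alt_mult_alternative)
qed

lemma relator_in_alt_ideal:
  "free_mult (gen_embed f) (gen_embed g) - free_mult (gen_embed g) (gen_embed f) - gen_embed (malcev_bracket f g) \<in> alt_ideal"
  unfolding alt_ideal_def
  by (rule subsetD[OF generated_ideal_superset]) (auto simp: env_relators_def Let_def)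

lemma alt_gen_commutator:
  "alt_mult (alt_gen g) (alt_gen h) - alt_mult (alt_gen h) (alt_gen g) =
    abs_alt_alg (gen_embed (malcev_table g h) :: gen word option \<Rightarrow>\<^sub>0 'f::field)"
proof -
  have "malcev_bracket (Poly_Mapping.single g 1) (Poly_Mapping.single h (1 :: 'f)) = malcev_table g h"
    by (simp add: malcev_bracket_def bilinear_ext_single)
  then show ?thesis
    using relator_in_alt_ideal[of "Poly_Mapping.single g (1 :: 'f)" "Poly_Mapping.single h 1"]
    by (simp add: alt_gen.abs_eq alt_mult.abs_eq minus_alt_alg.abs_eq alt_alg.abs_eq_iff)
qed

lemma abs_alt_alg_gen:
  "abs_alt_alg 0 = 0" "abs_alt_alg (Poly_Mapping.single (Some (Gen g)) 1) = alt_gen g"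
  by (simp_all add: zero_alt_alg.abs_eq alt_gen.abs_eq)

lemma malcev_envelope_alt:
  assumes "(6 :: 'f::field) \<noteq> 0"
  shows "malcev_envelope alt_scale alt_mult (alt_one :: 'f alt_alg)
    (alt_gen gen.a) (alt_gen gen.b) (alt_gen gen.c) (alt_gen gen.d) (alt_gen gen.e)"
proof -
  interpret alternative_algebra alt_scale alt_mult "alt_one :: 'f alt_alg"
    by (rule alternative_algebra_alt)
  have comm: "comm (alt_gen g) (alt_gen h) = abs_alt_alg (gen_embed (malcev_table g h))" for g h
    by (simp add: comm_def alt_gen_commutator)
  show ?thesis
  proof (unfold_locales, goal_cases)
    \<comment> \<open>Goal 12 is the assumption \<open>generated\<close>: membership in
      \<open>S\<close> passes from generators to words and then, by linearity, to all
      classes.\<close>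
    case (12 S)
    have gen: "alt_gen g \<in> S" for g
      using 12(3) by (cases g) auto
    have word: "abs_alt_alg (Poly_Mapping.single (Some w) 1) \<in> S" for w
    proof (induction w)
      case (Gen g)
      show ?case by (simp add: abs_alt_alg_gen gen)
    next
      case (Prod u v)
      have "abs_alt_alg (Poly_Mapping.single (Some (Prod u v)) 1 :: _ \<Rightarrow>\<^sub>0 'f) =
        alt_mult (abs_alt_alg (Poly_Mapping.single (Some u) 1)) (abs_alt_alg (Poly_Mapping.single (Some v) 1))"
        by (simp add: alt_mult.abs_eq bilinear_ext_single)
      then show ?case
        using 12(4)[OF Prod] by simp
    qed
    have "abs_alt_alg x \<in> S" for x
    proof (induction x rule: poly_mapping_additive_induct)
      case (single w t)
      have "abs_alt_alg (Poly_Mapping.single w t) = alt_scale t (abs_alt_alg (Poly_Mapping.single w 1))"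
        by (simp add: alt_scale.abs_eq)
      moreover have "abs_alt_alg (Poly_Mapping.single w 1) \<in> S"
        using word 12(2) by (cases w) (simp_all add: alt_one.abs_eq)
      ultimately show ?case
        using 12(1) by (simp add: subspace_scale)
    next
      case (add x y)
      then show ?case
        using 12(1) by (simp add: subspace_add flip: plus_alt_alg.abs_eq)
    qed
    then have "X \<in> S" for X
      by (induction X rule: alt_alg.abs_induct)
    then show ?case by blast
  qed (simp_all add: assms comm abs_alt_alg_gen)
qed

text \<open>In these products the table has no correction term: the leading variable does not come
  after any variable of the right operand, or that operand is a multiple of e.\<close>

lemma gen_symb_mult:
  "symb_mult (sy (ABCD 1 0 0 0)) (sy (ABCD i j k l)) = sy (ABCD (Suc i) j k l)"
  "symb_mult (sy (ABCD 0 1 0 0)) (sy (ABCD 0 j k l)) = sy (ABCD 0 (Suc j) k l)"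
  "symb_mult (sy (ABCD 0 0 1 0)) (sy (ABCD 0 0 k l)) = sy (ABCD 0 0 (Suc k) l)"
  "symb_mult (sy (ABCD 0 0 0 1)) (sy (ABCD 0 0 0 l)) = sy (ABCD 0 0 0 (Suc l))"
  "symb_mult (sy (ABCD 1 0 0 0)) (sy (ABDE i j l)) = sy (ABDE (Suc i) j l)"
  "symb_mult (sy (ABCD 0 1 0 0)) (sy (ABDE i j l)) = sy (ABDE i (Suc j) l)"
  "symb_mult (sy (ABCD 0 0 0 1)) (sy (ABDE i j l)) = sy (ABDE i j (Suc l))"
  by (simp_all add: bilinear_ext_single)

text \<open>The map \<open>nf\<close> sends each symbol to its left-tapped word. It is onto because
  these words span, and the last property says that evaluation is a left inverse, so
  \<open>nf\<close> is also injective.\<close>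

lemma exists_abs_normal_form:
  assumes "(6 :: 'f::field) \<noteq> 0"
  obtains nf :: "(symb \<Rightarrow>\<^sub>0 'f::field) \<Rightarrow> 'f alt_alg"
  where "nf 0 = 0" "surj nf" "\<And>x y. nf y = abs_alt_alg x \<Longrightarrow> ev x = y"
proof -
  interpret malcev_envelope alt_scale alt_mult "alt_one :: 'f alt_alg"
    "alt_gen gen.a" "alt_gen gen.b" "alt_gen gen.c" "alt_gen gen.d" "alt_gen gen.e"
    by (rule malcev_envelope_alt[OF assms])
  define nf where "nf = lin_ext alt_scale monomial"
  have nf_add: "nf (x + y) = nf x + nf y" and nf_scale: "nf (scale t x) = alt_scale t (nf x)" for x y t
    by (simp_all add: nf_def lin_ext_add lin_ext_scale)
  have nf_0: "nf 0 = 0"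
    by (simp add: nf_def)
  have "subspace (range nf)"
    unfolding subspace_def using nf_0
    by (auto simp flip: nf_add nf_scale)
  moreover have "monomial u \<in> range nf" for u
    by (rule image_eqI[of _ _ "sy u"]) (simp_all add: nf_def)
  ultimately have "span (range monomial) \<subseteq> range nf"
    by (intro span_minimal) auto
  then have surj: "surj nf"
    by (simp add: span_monomial top.extremum_unique)
  \<comment> \<open>The evaluation induced on the quotient; it does not depend on the representative
    because \<open>alt_ideal\<close> lies in the kernel of \<open>ev\<close>.\<close>
  define val where "val X = ev (rep_alt_alg X)" for X :: "'f alt_alg"
  have val_abs: "val (abs_alt_alg x) = ev x" for x
  proof -
    have "rep_alt_alg (abs_alt_alg x) - x \<in> alt_ideal"
      by (metis alt_alg.abs_eq_iff Quotient3_abs_rep[OF Quotient3_alt_alg])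
    then show ?thesis
      using alt_ideal_subset_kernel[OF assms] by (fastforce simp: val_def ev_diff)
  qed
  have val_mult: "val (alt_mult X Y) = symb_mult (val X) (val Y)" for X Y
    by (induction X rule: alt_alg.abs_induct, induction Y rule: alt_alg.abs_induct)
      (simp add: alt_mult.abs_eq val_abs ev_mult)
  have val_gen: "val (alt_gen g) = sy (gen_symb g)" for g
    by (simp add: alt_gen.abs_eq val_abs)
  have val_one: "val alt_one = sy (ABCD 0 0 0 0)"
    by (simp add: alt_one.abs_eq val_abs)
  have val_d: "val ((alt_mult (alt_gen gen.d) ^^ l) alt_one) = sy (ABCD 0 0 0 l)" for l
    by (induction l) (simp_all add: val_one val_mult val_gen gen_symb_mult[unfolded One_nat_def])
  have val_c: "val ((alt_mult (alt_gen gen.c) ^^ k) X) = sy (ABCD 0 0 k l)" if "val X = sy (ABCD 0 0 0 l)" for k l X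
    by (induction k) (simp_all add: that val_mult val_gen gen_symb_mult[unfolded One_nat_def])
  have val_b: "val ((alt_mult (alt_gen gen.b) ^^ j) X) = sy (ABCD 0 j k l)" if "val X = sy (ABCD 0 0 k l)" for j k l X
    by (induction j) (simp_all add: that val_mult val_gen gen_symb_mult[unfolded One_nat_def])
  have val_a: "val ((alt_mult (alt_gen gen.a) ^^ i) X) = sy (ABCD i j k l)" if "val X = sy (ABCD 0 j k l)" for i j k l X
    by (induction i) (simp_all add: that val_mult val_gen gen_symb_mult[unfolded One_nat_def])
  have val_de: "val ((alt_mult (alt_gen gen.d) ^^ l) (alt_gen gen.e)) = sy (ABDE 0 0 l)" for l
    by (induction l) (simp_all add: val_mult val_gen gen_symb_mult[unfolded One_nat_def])
  have val_bde: "val ((alt_mult (alt_gen gen.b) ^^ j) X) = sy (ABDE 0 j l)" if "val X = sy (ABDE 0 0 l)" for j l X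
    by (induction j) (simp_all add: that val_mult val_gen gen_symb_mult[unfolded One_nat_def])
  have val_abde: "val ((alt_mult (alt_gen gen.a) ^^ i) X) = sy (ABDE i j l)" if "val X = sy (ABDE 0 j l)" for i j l X
    by (induction i) (simp_all add: that val_mult val_gen gen_symb_mult[unfolded One_nat_def])
  have val_monomial: "val (monomial u) = sy u" for u
    by (cases u) (simp_all add: val_a[OF val_b[OF val_c[OF val_d]]] val_abde[OF val_bde[OF val_de]])
  have val_add: "val (X + Y) = val X + val Y" for X Y
    by (induction X rule: alt_alg.abs_induct, induction Y rule: alt_alg.abs_induct)
      (simp add: plus_alt_alg.abs_eq val_abs ev_add)
  have val_scale: "val (alt_scale t X) = scale t (val X)" for t X
    by (induction X rule: alt_alg.abs_induct) (simp add: alt_scale.abs_eq val_abs ev_scale)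
  have "val (nf y) = y" for y
  proof (induction y rule: poly_mapping_additive_induct)
    case (single u t)
    show ?case by (simp add: nf_def val_scale val_monomial)
  qed (simp add: nf_add val_add)
  then have "ev x = y" if "nf y = abs_alt_alg x" for x y
    using that by (metis val_abs)
  with nf_0 surj show ?thesis
    by (rule that)
qed

text \<open>Writing the class of x as \<open>nf y\<close> gives \<open>ev x = y\<close>; if this is
  0, the class of x is \<open>nf 0 = 0\<close>.\<close>

lemma ev_kernel:
  assumes "(6 :: 'f::field) \<noteq> 0"
  shows "ev (x :: gen word option \<Rightarrow>\<^sub>0 'f) = 0 \<longleftrightarrow> x \<in> alt_ideal"
proof
  assume "ev x = 0"
  obtain nf :: "(symb \<Rightarrow>\<^sub>0 'f) \<Rightarrow> 'f alt_alg" where nf: "nf 0 = 0" "surj nf"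
    "\<And>x y. nf y = abs_alt_alg x \<Longrightarrow> ev x = y"
    using exists_abs_normal_form[OF assms] by metis
  obtain y where y: "nf y = abs_alt_alg x"
    using \<open>surj nf\<close> by (metis surjD)
  with nf(3) \<open>ev x = 0\<close> have "y = 0"
    by metis
  with y nf(1) have "abs_alt_alg x = abs_alt_alg 0"
    by (simp add: abs_alt_alg_gen)
  then show "x \<in> alt_ideal"
    by (simp add: alt_alg.abs_eq_iff)
qed (rule alt_ideal_subset_kernel[OF assms])

lemma surj_ev:
  assumes "(6 :: 'f::field) \<noteq> 0"
  shows "surj (ev :: (gen word option \<Rightarrow>\<^sub>0 'f) \<Rightarrow> _)"
proof -
  obtain nf :: "(symb \<Rightarrow>\<^sub>0 'f) \<Rightarrow> 'f alt_alg" where "\<And>x y. nf y = abs_alt_alg x \<Longrightarrow> ev x = y"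
    using exists_abs_normal_form[OF assms] by metis
  then have "ev (rep_alt_alg (nf y)) = y" for y
    by (metis Quotient3_abs_rep[OF Quotient3_alt_alg])
  then show ?thesis
    by (rule surjI)
qed

lemma six_neq_0:
  assumes "CHAR('f::field) \<noteq> 2" "CHAR('f) \<noteq> 3"
  shows "(6 :: 'f) \<noteq> 0"
proof
  assume "(6 :: 'f) = 0"
  then have "(of_nat 2 :: 'f) * of_nat 3 = 0"
    by simp
  then have "CHAR('f) dvd 2 \<or> CHAR('f) dvd 3"
    by (simp only: mult_eq_0_iff of_nat_eq_0_iff_char_dvd)
  moreover have "m = 1 \<or> m = p" if "m dvd p" "p = 2 \<or> p = 3" for m p :: nat
  proof -
    have "m \<le> 3"
      using that dvd_imp_le[OF that(1)] by auto
    moreover have "m \<noteq> 0"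
      using that by (cases "m = 0") auto
    ultimately consider "m = 1" | "m = 2" | "m = 3"
      by linarith
    then show ?thesis
      using that by cases auto
  qed
  moreover have "CHAR('f) \<noteq> 1"
    by simp
  ultimately show False
    using assms by blast
qed

theorem corollary5p10:
  assumes "CHAR('f::field) \<noteq> 2" and "CHAR('f) \<noteq> 3"
  shows "\<exists>\<phi>. \<phi> \<in> alg_iso
           (alternative_env (malcev_bracket :: (gen \<Rightarrow>\<^sub>0 'f) \<Rightarrow> (gen \<Rightarrow>\<^sub>0 'f) \<Rightarrow> (gen \<Rightarrow>\<^sub>0 'f)))
           (symb_algebra :: ('f, symb \<Rightarrow>\<^sub>0 'f) module)"
proof -
  have six: "(6 :: 'f) \<noteq> 0"
    using assms by (rule six_neq_0)
  define R :: "(gen word option \<Rightarrow>\<^sub>0 'f) set" where "R = generated_ideal free_algebra relators"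
  define U where "U = quotient_algebra free_algebra R"
  have env: "nonassoc_env malcev_bracket = U"
    by (simp add: nonassoc_env_def U_def R_def)
  interpret R: algebra_record_ideal free_algebra R
    by unfold_locales (simp add: R_def F.alg_ideal_generated)
  interpret U: algebra_record U
    unfolding U_def by (rule R.algebra_record_Q)
  interpret cls: algebra_record_hom free_algebra U R.cls
    by unfold_locales (simp add: U_def R.cls_hom)
  have "ev x = 0" if "x \<in> R" for x
  proof -
    have "R \<subseteq> {x \<in> carrier free_algebra. ev x = (\<zero>\<^bsub>symb_algebra\<^esub> :: symb \<Rightarrow>\<^sub>0 'f)}"
      unfolding R_def
      by (rule generated_ideal_minimal[OF ev.kernel_alg_ideal]) (use ev_relators[OF six] in auto)
    with that show ?thesis by auto
  qed
  \<comment> \<open>\<open>g\<close> is the evaluation on U(M), which exists because the defining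
    relators evaluate to 0.\<close>
  then obtain g where g: "g \<in> alg_hom U symb_algebra" "\<And>x. g (R.cls x) = ev x"
    using R.lift[OF S.algebra_record_axioms ev_hom] unfolding U_def
    by (metis UNIV_I free_algebra_simps(1) symb_algebra_simps(4))
  interpret g: algebra_record_hom U symb_algebra g
    by unfold_locales (rule g)
  interpret I: algebra_record_ideal U "alternator_ideal U"
    by unfold_locales (simp add: alternator_ideal_eq U.alg_ideal_generated U.alternators_closed)
  have "alternator_ideal U \<subseteq> {X \<in> carrier U. g X = \<zero>\<^bsub>symb_algebra\<^esub>}"
    unfolding alternator_ideal_eq
  proof (rule generated_ideal_minimal[OF g.kernel_alg_ideal])
    show "alternators U \<subseteq> {X \<in> carrier U. g X = \<zero>\<^bsub>symb_algebra\<^esub>}"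
      by (auto simp: alternators_def U.associator_closed g.h_associator symb_associator[OF six])
  qed
  then have ker1: "g X = 0" if "X \<in> alternator_ideal U" for X
    using that by auto
  \<comment> \<open>The converse inclusion for the kernel of \<open>g\<close>: relators become 0 in
    \<open>U\<close> and alternators go to alternators, so by \<open>ev_kernel\<close> every class
    evaluating to 0 lies in the alternator ideal.\<close>
  have "alt_ideal \<subseteq> {x \<in> carrier free_algebra. R.cls x \<in> alternator_ideal U}"
    unfolding alt_ideal_def
  proof (rule generated_ideal_minimal[OF cls.vimage_alg_ideal[OF I.I]], intro subsetI, elim UnE)
    fix x :: "gen word option \<Rightarrow>\<^sub>0 'f" assume "x \<in> relators"
    then have "x \<in> R"
      using generated_ideal_superset[of relators free_algebra] by (auto simp: R_def)
    then have "R.cls x = R.cls 0"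
      by (simp add: R.cls_eq_iff)
    also have "\<dots> = \<zero>\<^bsub>U\<^esub>"
      using cls.h_zero by simp
    finally show "x \<in> {x \<in> carrier free_algebra. R.cls x \<in> alternator_ideal U}"
      using I.I_simps(2) by simp
  next
    fix x :: "gen word option \<Rightarrow>\<^sub>0 'f" assume "x \<in> alternators free_algebra"
    then have "R.cls x \<in> alternators U"
      by (rule cls.h_alternators)
    then show "x \<in> {x \<in> carrier free_algebra. R.cls x \<in> alternator_ideal U}"
      using generated_ideal_superset[of "alternators U" U] by (auto simp: alternator_ideal_eq)
  qed
  then have ker2: "R.cls x \<in> alternator_ideal U" if "ev x = 0" for x
    using that ev_kernel[OF six] by auto
  have carrier_U: "X \<in> carrier U \<Longrightarrow> \<exists>x. X = R.cls x" for X
    using R.carrier_Q by (auto simp: U_def)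
  have "\<exists>\<phi>. \<phi> \<in> alg_iso (quotient_algebra U (alternator_ideal U)) symb_algebra"
  proof (rule I.lift_iso[OF S.algebra_record_axioms g(1)])
    have "y \<in> g ` carrier U" for y
    proof -
      obtain x where "y = ev x"
        using surj_ev[OF six] by (metis surjD)
      then show ?thesis
        using cls.h_simps(1)[of x] by (auto simp: g(2)[symmetric])
    qed
    then show "g ` carrier U = carrier symb_algebra"
      by auto
    show "g X = \<zero>\<^bsub>symb_algebra\<^esub> \<longleftrightarrow> X \<in> alternator_ideal U" if "X \<in> carrier U" for X
      using carrier_U[OF that] ker1 ker2 by (auto simp: g(2))
  qed
  then show ?thesis
    by (simp add: alternative_env_def env)
qed

end
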